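(* Let $K$ be any field and let $E$ be any directed graph. Let $p$ be an irrational infinite path in $E$ such that no vertex of $p$ is an infinite emitter. Then the Chen simple left $L_K(E)$-module $V_{[p]}$ is finitely presented if and only if $X_i(p)$ is nonempty for only finitely many indices $i$. In particular, if $E$ is a finite graph, then $V_{[p]}$ is not finitely presented.
   Context: A directed graph $E=(E^0,E^1,s,r)$ consists of a set $E^0$ of vertices, a set $E^1$ of edges, and maps $s,r:E^1\to E^0$ (source and range); $E$ is finite if $E^0$ and $E^1$ are finite. An infinite emitter is a vertex $u$ with $s^{-1}(u)$ infinite. A path of length $n\ge 1$ is a sequence $\alpha=e_1\cdots e_n$ of edges with $r(e_i)=s(e_{i+1})$; it is closed if $r(e_n)=s(e_1)$. The Leavitt path algebra $L_K(E)$ is the $K$-algebra generated by $\{v: v\in E^0\}\cup\{e,e^*: e\in E^1\}$ with relations: (V) $vu=\delta_{v,u}v$ for $v,u\in E^0$; (E1) $s(e)e=er(e)=e$; (E2) $r(e)e^*=e^*s(e)=e^*$ for $e\in E^1$; (CK1) $e^*e'=\delta_{e,e'}r(e)$ for $e,e'\in E^1$; (CK2) $v=\sum_{e\in s^{-1}(v)}ee^*$ for every $v\in E^0$ with $0<|s^{-1}(v)|<\infty$. When $E^0$ is infinite, $L_K(E)$ is a non-unital ring with local units, and "finitely presented" is understood for left modules $M$ with $L_K(E)M=M$. An infinite path is a sequence $p=e_1e_2e_3\cdots$ of edges with $r(e_i)=s(e_{i+1})$ for all $i$; $\tau_{>n}(p)=e_{n+1}e_{n+2}\cdots$. Infinite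 paths $p,q$ are tail equivalent ($p\sim q$) if $\tau_{>m}(p)=\tau_{>n}(q)$ for some $m,n\ge0$; $[p]$ is the class of $p$. An infinite path is rational if it is tail equivalent to $c^\infty=ccc\cdots$ for some closed path $c$, and irrational otherwise. The Chen simple module $V_{[p]}$ is the $K$-vector space with basis $[p]$ and left $L_K(E)$-action determined, for $q=f_1f_2\cdots\in[p]$, $v\in E^0$, $e\in E^1$, by: $v\cdot q=q$ if $v=s(f_1)$ and $0$ otherwise; $e\cdot q=eq$ if $r(e)=s(f_1)$ and $0$ otherwise; $e^*\cdot q=\tau_{>1}(q)$ if $e=f_1$ and $0$ otherwise. For $p=e_1e_2\cdots$ and $i\ge 0$, $X_i(p)=\{f\in E^1: s(f)=s(e_{i+1}),\ f\ne e_{i+1}\}$. *)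

theory Defs
  imports
    "HOL-Algebra.QuotRing"
    "HOL-Algebra.Module"
    "HOL-Algebra.Generated_Groups"
    "HOL-Library.Poly_Mapping"
    "Graph_Theory.Digraph"
    "Graph_Theory.Arc_Walk"
begin

section \<open>Modules over rings without identity\<close>

text \<open>
  \<^locale>\<open>ring\<close> and \<^locale>\<open>module\<close> require an identity (and
  commutativity of the scalars, for the latter). A ring without identity is represented here by
  a \<^type>\<open>ring\<close> record whose field \<^const>\<open>one\<close> is ignored; likewise the fields
  \<^const>\<open>mult\<close> and \<^const>\<open>one\<close> of a module record are ignored.
\<close>

locale nonunital_ring = abelian_group R for R (structure) +
  assumes m_closed: "\<lbrakk>a \<in> carrier R; b \<in> carrier R\<rbrakk> \<Longrightarrow> a \<otimes> b \<in> carrier R"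
    and m_assoc: "\<lbrakk>a \<in> carrier R; b \<in> carrier R; c \<in> carrier R\<rbrakk> \<Longrightarrow>
      (a \<otimes> b) \<otimes> c = a \<otimes> (b \<otimes> c)"
    and l_distr: "\<lbrakk>a \<in> carrier R; b \<in> carrier R; c \<in> carrier R\<rbrakk> \<Longrightarrow>
      (a \<oplus> b) \<otimes> c = a \<otimes> c \<oplus> b \<otimes> c"
    and r_distr: "\<lbrakk>a \<in> carrier R; b \<in> carrier R; c \<in> carrier R\<rbrakk> \<Longrightarrow>
      a \<otimes> (b \<oplus> c) = a \<otimes> b \<oplus> a \<otimes> c"

locale left_module = R?: nonunital_ring R + M?: abelian_group M
  for R (structure) and M (structure) +
  assumes smult_closed: "\<lbrakk>a \<in> carrier R; x \<in> carrier M\<rbrakk> \<Longrightarrow> a \<odot>\<^bsub>M\<^esub> x \<in> carrier M"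
    and smult_l_distr: "\<lbrakk>a \<in> carrier R; b \<in> carrier R; x \<in> carrier M\<rbrakk> \<Longrightarrow>
      (a \<oplus> b) \<odot>\<^bsub>M\<^esub> x = a \<odot>\<^bsub>M\<^esub> x \<oplus>\<^bsub>M\<^esub> b \<odot>\<^bsub>M\<^esub> x"
    and smult_r_distr: "\<lbrakk>a \<in> carrier R; x \<in> carrier M; y \<in> carrier M\<rbrakk> \<Longrightarrow>
      a \<odot>\<^bsub>M\<^esub> (x \<oplus>\<^bsub>M\<^esub> y) = a \<odot>\<^bsub>M\<^esub> x \<oplus>\<^bsub>M\<^esub> a \<odot>\<^bsub>M\<^esub> y"
    and smult_assoc: "\<lbrakk>a \<in> carrier R; b \<in> carrier R; x \<in> carrier M\<rbrakk> \<Longrightarrow>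
      (a \<otimes> b) \<odot>\<^bsub>M\<^esub> x = a \<odot>\<^bsub>M\<^esub> (b \<odot>\<^bsub>M\<^esub> x)"

text \<open>The additional axiom is \<open>R M = M\<close>: finite sums of products \<open>a x\<close> exhaust \<open>M\<close>.\<close>

locale unital_left_module = left_module +
  assumes smult_span:
    "generate (add_monoid M) {a \<odot>\<^bsub>M\<^esub> x | a x. a \<in> carrier R \<and> x \<in> carrier M} = carrier M"

definition left_module_hom ::
  "('a, 'r) ring_scheme \<Rightarrow> ('a, 'b, 's) module_scheme \<Rightarrow> ('a, 'c, 't) module_scheme \<Rightarrow> ('b \<Rightarrow> 'c) set"
where
  "left_module_hom R M N =
     {f \<in> hom (add_monoid M) (add_monoid N).
        \<forall>a\<in>carrier R. \<forall>x\<in>carrier M. f (a \<odot>\<^bsub>M\<^esub> x) = a \<odot>\<^bsub>N\<^esub> f x}"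

definition fg_submodule ::
  "('a, 'r) ring_scheme \<Rightarrow> ('a, 'b, 's) module_scheme \<Rightarrow> 'b set \<Rightarrow> bool"
where
  "fg_submodule R M N \<longleftrightarrow> submodule N R M \<and>
     (\<exists>S. finite S \<and> S \<subseteq> N \<and> (\<forall>N'. submodule N' R M \<longrightarrow> S \<subseteq> N' \<longrightarrow> N \<subseteq> N'))"

text \<open>The direct sum \<open>R e\<^sub>0 \<oplus> \<dots> \<oplus> R e\<^bsub>n-1\<^esub>\<close> of left ideals.\<close>

definition left_ideal_sum ::
  "('a, 'r) ring_scheme \<Rightarrow> nat \<Rightarrow> (nat \<Rightarrow> 'a) \<Rightarrow> ('a, nat \<Rightarrow> 'a) module"
where
  "left_ideal_sum R n e =
     \<lparr>carrier = (\<Pi>\<^sub>E i\<in>{..<n}. {a \<otimes>\<^bsub>R\<^esub> e i | a. a \<in> carrier R}),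
      mult = undefined,
      one = undefined,
      zero = (\<lambda>i\<in>{..<n}. \<zero>\<^bsub>R\<^esub>),
      add = (\<lambda>x y. \<lambda>i\<in>{..<n}. x i \<oplus>\<^bsub>R\<^esub> y i),
      smult = (\<lambda>a x. \<lambda>i\<in>{..<n}. a \<otimes>\<^bsub>R\<^esub> x i)\<rparr>"

text \<open>
  Over a ring with local units the modules \<open>R e\<close>, for \<open>e\<close> idempotent, are finitely generated
  and projective, and finite direct sums of them replace the finitely generated free modules
  (which need not be finitely generated when \<open>R\<close> has no identity). A unital left module is finitely
  presented if it is the quotient of such a sum by a finitely generated submodule. If \<open>R\<close> has
  an identity this is the usual notion.
\<close>

definition finitely_presented ::
  "('a, 'r) ring_scheme \<Rightarrow> ('a, 'b, 's) module_scheme \<Rightarrow> bool"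
where
  "finitely_presented R M \<longleftrightarrow> unital_left_module R M \<and>
     (\<exists>n e f. (\<forall>i<n. e i \<in> carrier R \<and> e i \<otimes>\<^bsub>R\<^esub> e i = e i) \<and>
        f \<in> left_module_hom R (left_ideal_sum R n e) M \<and>
        f ` carrier (left_ideal_sum R n e) = carrier M \<and>
        fg_submodule R (left_ideal_sum R n e) (a_kernel (left_ideal_sum R n e) M f))"


section \<open>The free associative algebra\<close>

datatype 'g free_monoid = Word (letters: "'g list")

text \<open>
  The monoid operation is written additively, as this is how \<^theory>\<open>HOL-Library.Poly_Mapping\<close>
  obtains the multiplication of the monoid algebra. Thus \<open>'g free_monoid \<Rightarrow>\<^sub>0 'k\<close> is the unital
  free associative \<open>'k\<close>-algebra on the letters \<open>'g\<close>.
\<close>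

instantiation free_monoid :: (type) monoid_add
begin

definition zero_free_monoid :: "'a free_monoid" where
  "0 = Word []"

definition plus_free_monoid :: "'a free_monoid \<Rightarrow> 'a free_monoid \<Rightarrow> 'a free_monoid" where
  "v + w = Word (letters v @ letters w)"

instance
  by standard (auto simp: zero_free_monoid_def plus_free_monoid_def)

end

definition free_algebra :: "'g set \<Rightarrow> ('g free_monoid \<Rightarrow>\<^sub>0 'k::field) ring" where
  "free_algebra X =
     \<lparr>carrier = {a. \<forall>w\<in>Poly_Mapping.keys a. set (letters w) \<subseteq> X},
      mult = (*), one = 1, zero = 0, add = (+)\<rparr>"

definition letter :: "'g \<Rightarrow> ('g free_monoid \<Rightarrow>\<^sub>0 'k::field)" where
  "letter g = Poly_Mapping.single (Word [g]) 1"


section \<open>Leavitt path algebras\<close>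

datatype ('v, 'e) lpa_gen = Vertex 'v | Edge 'e | Ghost 'e

definition lpa_gens :: "('v, 'e) pre_digraph \<Rightarrow> ('v, 'e) lpa_gen set" where
  "lpa_gens E = Vertex ` verts E \<union> Edge ` arcs E \<union> Ghost ` arcs E"

definition lpa_relations ::
  "('v, 'e) pre_digraph \<Rightarrow> (('v, 'e) lpa_gen free_monoid \<Rightarrow>\<^sub>0 'k::field) set"
where
  "lpa_relations E =
     {letter (Vertex v) * letter (Vertex u) - (if v = u then letter (Vertex v) else 0) | v u.
        v \<in> verts E \<and> u \<in> verts E} \<union>
     {letter (Vertex (tail E e)) * letter (Edge e) - letter (Edge e) | e. e \<in> arcs E} \<union>
     {letter (Edge e) * letter (Vertex (head E e)) - letter (Edge e) | e. e \<in> arcs E} \<union>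
     {letter (Vertex (head E e)) * letter (Ghost e) - letter (Ghost e) | e. e \<in> arcs E} \<union>
     {letter (Ghost e) * letter (Vertex (tail E e)) - letter (Ghost e) | e. e \<in> arcs E} \<union>
     {letter (Ghost e) * letter (Edge f) - (if e = f then letter (Vertex (head E e)) else 0) | e f.
        e \<in> arcs E \<and> f \<in> arcs E} \<union>
     {letter (Vertex v) - (\<Sum>e\<in>out_arcs E v. letter (Edge e) * letter (Ghost e)) | v.
        v \<in> verts E \<and> finite (out_arcs E v) \<and> out_arcs E v \<noteq> {}}"

definition lpa_ideal ::
  "('v, 'e) pre_digraph \<Rightarrow> (('v, 'e) lpa_gen free_monoid \<Rightarrow>\<^sub>0 'k::field) set"
where
  "lpa_ideal E = genideal (free_algebra (lpa_gens E)) (lpa_relations E)"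

text \<open>
  The algebra is generated without adjoining an identity, so it consists of the classes of the
  noncommutative polynomials without constant term. As the relations have no constant term, an
  element of \<^const>\<open>lpa_ideal\<close> has none either, and the ideal generated in the
  unital free algebra is also the algebra ideal generated in the nonunital one. The \<^const>\<open>one\<close>
  field of the record is a remnant of the unital quotient and not an element of the carrier.
\<close>

definition leavitt_path_algebra ::
  "'k::field itself \<Rightarrow> ('v, 'e) pre_digraph \<Rightarrow> (('v, 'e) lpa_gen free_monoid \<Rightarrow>\<^sub>0 'k) set ring"
where
  "leavitt_path_algebra K E =
     (free_algebra (lpa_gens E) Quot lpa_ideal E)
       \<lparr>carrier := {a_r_coset (free_algebra (lpa_gens E)) (lpa_ideal E) a | a.
          a \<in> carrier (free_algebra (lpa_gens E)) \<and> Poly_Mapping.lookup a 0 = 0}\<rparr>"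


section \<open>Infinite paths and Chen modules\<close>

text \<open>An infinite path \<open>e\<^sub>1 e\<^sub>2 \<dots>\<close> is represented by \<open>p\<close> with \<open>p i = e\<^bsub>i+1\<^esub>\<close>.\<close>

definition infinite_path :: "('v, 'e) pre_digraph \<Rightarrow> (nat \<Rightarrow> 'e) \<Rightarrow> bool" where
  "infinite_path E p \<longleftrightarrow> (\<forall>i. p i \<in> arcs E \<and> head E (p i) = tail E (p (Suc i)))"

definition path_tail :: "nat \<Rightarrow> (nat \<Rightarrow> 'e) \<Rightarrow> nat \<Rightarrow> 'e" where
  "path_tail n p = (\<lambda>i. p (n + i))"

definition tail_equivalent :: "(nat \<Rightarrow> 'e) \<Rightarrow> (nat \<Rightarrow> 'e) \<Rightarrow> bool" where
  "tail_equivalent p q \<longleftrightarrow> (\<exists>m n. path_tail m p = path_tail n q)"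

definition tail_class :: "('v, 'e) pre_digraph \<Rightarrow> (nat \<Rightarrow> 'e) \<Rightarrow> (nat \<Rightarrow> 'e) set" where
  "tail_class E p = {q. infinite_path E q \<and> tail_equivalent p q}"

definition list_power_inf :: "'e list \<Rightarrow> nat \<Rightarrow> 'e" where
  "list_power_inf c = (\<lambda>i. c ! (i mod length c))"

text \<open>\<^const>\<open>wf_digraph.closed_w\<close> allows repeated vertices and excludes the empty walk.\<close>

definition rational_path :: "('v, 'e) pre_digraph \<Rightarrow> (nat \<Rightarrow> 'e) \<Rightarrow> bool" where
  "rational_path E p \<longleftrightarrow> infinite_path E p \<and>
     (\<exists>c. wf_digraph.closed_w E c \<and> tail_equivalent p (list_power_inf c))"

definition irrational_path :: "('v, 'e) pre_digraph \<Rightarrow> (nat \<Rightarrow> 'e) \<Rightarrow> bool" where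
  "irrational_path E p \<longleftrightarrow> infinite_path E p \<and> \<not> rational_path E p"

definition path_exits :: "('v, 'e) pre_digraph \<Rightarrow> (nat \<Rightarrow> 'e) \<Rightarrow> nat \<Rightarrow> 'e set" where
  "path_exits E p i = {f \<in> arcs E. tail E f = tail E (p i) \<and> f \<noteq> p i}"

text \<open>A generator maps a basis path to a basis path or to zero, the latter encoded by \<^const>\<open>None\<close>.\<close>

fun gen_act :: "('v, 'e) pre_digraph \<Rightarrow> ('v, 'e) lpa_gen \<Rightarrow> (nat \<Rightarrow> 'e) \<Rightarrow> (nat \<Rightarrow> 'e) option"
where
  "gen_act E (Vertex v) q = (if v = tail E (q 0) then Some q else None)"
| "gen_act E (Edge e) q = (if head E e = tail E (q 0) then Some (case_nat e q) else None)"
| "gen_act E (Ghost e) q = (if e = q 0 then Some (path_tail 1 q) else None)"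

primrec word_act ::
  "('v, 'e) pre_digraph \<Rightarrow> ('v, 'e) lpa_gen list \<Rightarrow> (nat \<Rightarrow> 'e) \<Rightarrow> (nat \<Rightarrow> 'e) option"
where
  "word_act E [] q = Some q"
| "word_act E (g # w) q = Option.bind (word_act E w q) (gen_act E g)"

text \<open>The bilinear extension to the free algebra and to formal combinations of paths.\<close>

definition free_act ::
  "('v, 'e) pre_digraph \<Rightarrow> (('v, 'e) lpa_gen free_monoid \<Rightarrow>\<^sub>0 'k::field) \<Rightarrow>
   ((nat \<Rightarrow> 'e) \<Rightarrow>\<^sub>0 'k) \<Rightarrow> ((nat \<Rightarrow> 'e) \<Rightarrow>\<^sub>0 'k)"
where
  "free_act E a x =
     (\<Sum>w\<in>Poly_Mapping.keys a. \<Sum>q\<in>Poly_Mapping.keys x.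
        case word_act E (letters w) q of
          None \<Rightarrow> 0
        | Some q' \<Rightarrow> Poly_Mapping.single q' (Poly_Mapping.lookup a w * Poly_Mapping.lookup x q))"

text \<open>
  An element \<open>A\<close> of the Leavitt path algebra is a coset; it acts through any of its
  representatives (the choice is immaterial, see \<open>chen_smult\<close> below).
\<close>

definition chen_module ::
  "'k::field itself \<Rightarrow> ('v, 'e) pre_digraph \<Rightarrow> (nat \<Rightarrow> 'e) \<Rightarrow>
   ((('v, 'e) lpa_gen free_monoid \<Rightarrow>\<^sub>0 'k) set, (nat \<Rightarrow> 'e) \<Rightarrow>\<^sub>0 'k) module"
where
  "chen_module K E p =
     \<lparr>carrier = {x. Poly_Mapping.keys x \<subseteq> tail_class E p},
      mult = undefined,
      one = undefined,
      zero = 0,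
      add = (+),
      smult = (\<lambda>A x. free_act E (SOME a. a \<in> A) x)\<rparr>"

section \<open>The Chen module is a unital left module\<close>

lemma free_algebra_simps [simp]:
  "carrier (free_algebra X) = {a. \<forall>w\<in>Poly_Mapping.keys a. set (letters w) \<subseteq> X}"
  "mult (free_algebra X) = (*)" "one (free_algebra X) = 1"
  "zero (free_algebra X) = 0" "add (free_algebra X) = (+)"
  by (simp_all add: free_algebra_def)

lemma chen_module_simps [simp]:
  "carrier (chen_module K E p) = {x. Poly_Mapping.keys x \<subseteq> tail_class E p}"
  "zero (chen_module K E p) = 0" "add (chen_module K E p) = (+)"
  by (simp_all add: chen_module_def)

lemma ring_free_algebra: "ring (free_algebra X :: ('g free_monoid \<Rightarrow>\<^sub>0 'k::field) ring)"
proof -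
  let ?F = "free_algebra X :: ('g free_monoid \<Rightarrow>\<^sub>0 'k) ring"
  show ?thesis
  proof (rule ringI)
    show "abelian_group ?F"
    proof (rule abelian_groupI)
      fix x y assume "x \<in> carrier ?F" "y \<in> carrier ?F"
      then show "x \<oplus>\<^bsub>?F\<^esub> y \<in> carrier ?F" using keys_add[of x y] by auto
    next
      fix x assume "x \<in> carrier ?F"
      then show "\<exists>y\<in>carrier ?F. y \<oplus>\<^bsub>?F\<^esub> x = \<zero>\<^bsub>?F\<^esub>"
        by (intro bexI[of _ "- x"]) auto
    qed (auto simp: add_ac)
    show "monoid ?F"
    proof (rule monoidI)
      fix x y assume xy: "x \<in> carrier ?F" "y \<in> carrier ?F"
      show "x \<otimes>\<^bsub>?F\<^esub> y \<in> carrier ?F"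
        using xy keys_mult[of x y] by (fastforce simp: plus_free_monoid_def)
    qed (auto simp: mult.assoc zero_free_monoid_def)
  qed (auto simp: algebra_simps)
qed

lemma keys_letter [simp]: "Poly_Mapping.keys (letter g :: 'g free_monoid \<Rightarrow>\<^sub>0 'k::field) = {Word [g]}"
  by (simp add: letter_def)

lemma letter_mult: "letter g * letter h = Poly_Mapping.single (Word [g, h]) 1"
  by (simp add: letter_def mult_single plus_free_monoid_def)

lemma free_monoid_eq_0_iff: "w = 0 \<longleftrightarrow> letters w = []"
  by (cases w) (simp add: zero_free_monoid_def)

lemma lookup_mult_0:
  fixes a b :: "'g free_monoid \<Rightarrow>\<^sub>0 'k::field"
  assumes "Poly_Mapping.lookup a 0 = 0"
  shows "Poly_Mapping.lookup (a * b) 0 = 0"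
proof (rule ccontr)
  assume "Poly_Mapping.lookup (a * b) 0 \<noteq> 0"
  then have "0 \<in> Poly_Mapping.keys (a * b)" by (simp add: in_keys_iff)
  then obtain u v where uv: "u \<in> Poly_Mapping.keys a" "0 = u + v"
    using keys_mult[of a b] by blast
  then have "u = 0"
    by (cases u) (simp add: plus_free_monoid_def zero_free_monoid_def)
  with uv assms show False by (simp add: in_keys_iff)
qed

lemma lpa_relations_carrier:
  assumes "wf_digraph E"
  shows "lpa_relations E \<subseteq> carrier (free_algebra (lpa_gens E) :: (_ \<Rightarrow>\<^sub>0 'k::field) ring)"
proof -
  interpret wf_digraph E by fact
  interpret F: ring "free_algebra (lpa_gens E) :: (_ \<Rightarrow>\<^sub>0 'k) ring" by (rule ring_free_algebra)
  let ?C = "carrier (free_algebra (lpa_gens E) :: (_ \<Rightarrow>\<^sub>0 'k) ring)"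
  have let_in: "letter g \<in> ?C" if "g \<in> lpa_gens E" for g using that by simp
  have mul_in: "a * b \<in> ?C" if "a \<in> ?C" "b \<in> ?C" for a b
    using F.m_closed[OF that] by simp
  have diff_in: "a - b \<in> ?C" if "a \<in> ?C" "b \<in> ?C" for a b
    using that keys_add[of a "- b"] by auto
  have sum_in: "(\<Sum>i\<in>I. g i) \<in> ?C" if "\<And>i. i \<in> I \<Longrightarrow> g i \<in> ?C" for g and I :: "'b set"
    using that keys_sum[of g I] by fastforce
  have zero_in: "0 \<in> ?C" by simp
  have V: "Vertex v \<in> lpa_gens E \<longleftrightarrow> v \<in> verts E" for v by (auto simp: lpa_gens_def)
  have Ed: "Edge e \<in> lpa_gens E \<longleftrightarrow> e \<in> arcs E" for e by (auto simp: lpa_gens_def)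
  have Gh: "Ghost e \<in> lpa_gens E \<longleftrightarrow> e \<in> arcs E" for e by (auto simp: lpa_gens_def)
  show ?thesis
    unfolding lpa_relations_def
    by (intro Un_least subsetI; (elim CollectE exE conjE)?; hypsubst;
        intro diff_in mul_in let_in sum_in)
      (auto simp: V Ed Gh simp del: free_algebra_simps intro!: let_in zero_in[simplified free_algebra_simps(4)])
qed

lemma ideal_lpa_ideal:
  assumes "wf_digraph E"
  shows "ideal (lpa_ideal E :: (_ \<Rightarrow>\<^sub>0 'k::field) set) (free_algebra (lpa_gens E))"
  unfolding lpa_ideal_def
  by (rule ring.genideal_ideal[OF ring_free_algebra lpa_relations_carrier[OF assms]])

abbreviation word_vec ::
  "('v, 'e) pre_digraph \<Rightarrow> ('v, 'e) lpa_gen free_monoid \<Rightarrow> (nat \<Rightarrow> 'e) \<Rightarrow> 'k::field \<Rightarrow>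
   ((nat \<Rightarrow> 'e) \<Rightarrow>\<^sub>0 'k)" where
  "word_vec E w q c \<equiv>
     (case word_act E (letters w) q of None \<Rightarrow> 0 | Some q' \<Rightarrow> Poly_Mapping.single q' c)"

lemma free_act_superset:
  assumes "finite A" "Poly_Mapping.keys a \<subseteq> A" "finite B" "Poly_Mapping.keys x \<subseteq> B"
  shows "free_act E a x =
    (\<Sum>w\<in>A. \<Sum>q\<in>B. word_vec E w q (Poly_Mapping.lookup a w * Poly_Mapping.lookup x q))"
proof -
  have "free_act E a x = (\<Sum>w\<in>Poly_Mapping.keys a. \<Sum>q\<in>B.
      word_vec E w q (Poly_Mapping.lookup a w * Poly_Mapping.lookup x q))"
    unfolding free_act_def
    by (intro sum.cong refl sum.mono_neutral_left assms)
      (auto simp: in_keys_iff split: option.split)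
  also have "\<dots> = (\<Sum>w\<in>A. \<Sum>q\<in>B.
      word_vec E w q (Poly_Mapping.lookup a w * Poly_Mapping.lookup x q))"
    by (intro sum.mono_neutral_left assms)
      (auto simp: in_keys_iff split: option.split intro!: sum.neutral)
  finally show ?thesis .
qed

lemma free_act_add_left: "free_act E (a + b) x = free_act E a x + free_act E b x"
proof -
  let ?A = "Poly_Mapping.keys a \<union> Poly_Mapping.keys b" and ?B = "Poly_Mapping.keys x"
  have k: "Poly_Mapping.keys (a + b) \<subseteq> ?A" by (rule keys_add)
  show ?thesis
    by (subst (1 2 3) free_act_superset[of ?A _ ?B])
      (use k in \<open>auto simp: lookup_add distrib_right single_add sum.distrib[symmetric]
         intro!: sum.cong split: option.split\<close>)
qed

lemma free_act_add_right: "free_act E a (x + y) = free_act E a x + free_act E a y"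
proof -
  let ?A = "Poly_Mapping.keys a" and ?B = "Poly_Mapping.keys x \<union> Poly_Mapping.keys y"
  have k: "Poly_Mapping.keys (x + y) \<subseteq> ?B" by (rule keys_add)
  show ?thesis
    by (subst (1 2 3) free_act_superset[of ?A _ ?B])
      (use k in \<open>auto simp: lookup_add distrib_left single_add sum.distrib[symmetric]
         intro!: sum.cong split: option.split\<close>)
qed

lemma free_act_0 [simp]: "free_act E 0 x = 0" "free_act E a 0 = 0"
  by (simp_all add: free_act_def)

lemma free_act_minus_left: "free_act E (- a) x = - free_act E a x"
proof -
  have "free_act E (- a) x + free_act E a x = 0"
    by (simp flip: free_act_add_left)
  then show ?thesis by (simp add: eq_neg_iff_add_eq_0)
qed

lemma free_act_diff_left: "free_act E (a - b) x = free_act E a x - free_act E b x"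
  using free_act_add_left[of E a "- b" x] by (simp add: free_act_minus_left)

lemma free_act_sum_left: "free_act E (\<Sum>i\<in>I. g i) x = (\<Sum>i\<in>I. free_act E (g i) x)"
  by (induction I rule: infinite_finite_induct) (auto simp: free_act_add_left)

lemma free_act_single:
  "free_act E (Poly_Mapping.single w c) (Poly_Mapping.single q d) = word_vec E w q (c * d)"
  by (subst free_act_superset[of "{w}" _ "{q}"]) (auto split: option.split)

lemma poly_mapping_add_induct [case_names zero single add]:
  fixes a :: "'a \<Rightarrow>\<^sub>0 'b::comm_monoid_add"
  assumes "P 0" "\<And>w c. w \<in> Poly_Mapping.keys a \<Longrightarrow> P (Poly_Mapping.single w c)"
    "\<And>x y. P x \<Longrightarrow> P y \<Longrightarrow> P (x + y)"
  shows "P a"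
proof -
  have "a = (\<Sum>w\<in>Poly_Mapping.keys a. Poly_Mapping.single w (Poly_Mapping.lookup a w))"
    by (rule poly_mapping_eqI)
      (auto simp: lookup_sum lookup_single when_def in_keys_iff)
  moreover have "P (\<Sum>w\<in>W. Poly_Mapping.single w (Poly_Mapping.lookup a w))"
    if "finite W" "W \<subseteq> Poly_Mapping.keys a" for W
    using that by (induction W) (auto intro: assms)
  ultimately show ?thesis by (metis finite_keys order_refl)
qed

lemma word_act_append:
  "word_act E (v @ w) q = Option.bind (word_act E w q) (word_act E v)"
  by (induction v) (auto simp: bind_eq_None_conv split: Option.bind_split)

lemma free_act_mult: "free_act E (a * b) x = free_act E a (free_act E b x)"
proof (induction a rule: poly_mapping_add_induct)
  case (single v c)
  show ?case
  proof (induction b rule: poly_mapping_add_induct)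
    case (single w d)
    show ?case
    proof (induction x rule: poly_mapping_add_induct)
      case (single q r)
      show ?case
        by (auto simp: mult_single free_act_single plus_free_monoid_def word_act_append mult.assoc
            split: option.split)
    qed (simp_all add: free_act_add_right)
  qed (simp_all add: free_act_add_right free_act_add_left distrib_left)
qed (simp_all add: free_act_add_left distrib_right)

lemma tail_equivalentI: "path_tail m p = path_tail n q \<Longrightarrow> tail_equivalent p q"
  by (auto simp: tail_equivalent_def)

lemma gen_act_tail_class:
  assumes "q \<in> tail_class E p" "g \<in> lpa_gens E" "gen_act E g q = Some q'"
  shows "q' \<in> tail_class E p"
proof -
  from assms(1) obtain m n where q: "infinite_path E q" "\<And>i. p (m + i) = q (n + i)"
    by (auto simp: tail_class_def tail_equivalent_def path_tail_def fun_eq_iff)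
  show ?thesis
  proof (cases g)
    case (Vertex v)
    with assms show ?thesis by (auto split: if_splits)
  next
    case (Edge e)
    with assms have e: "e \<in> arcs E" "head E e = tail E (q 0)" "q' = case_nat e q"
      by (auto simp: lpa_gens_def split: if_splits)
    then have "infinite_path E q'"
      using q(1) by (auto simp: infinite_path_def split: nat.split)
    moreover have "path_tail m p = path_tail (Suc n) q'"
      using q(2) e by (auto simp: path_tail_def)
    ultimately show ?thesis by (auto simp: tail_class_def intro: tail_equivalentI)
  next
    case (Ghost e)
    with assms have e: "q' = path_tail 1 q" by (auto split: if_splits)
    have "infinite_path E q'" using q(1) e by (auto simp: infinite_path_def path_tail_def)
    moreover have "path_tail (Suc m) p = path_tail n q'"
      using q(2)[of "Suc _"] e by (auto simp: path_tail_def fun_eq_iff)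
    ultimately show ?thesis by (auto simp: tail_class_def intro: tail_equivalentI)
  qed
qed

lemma word_act_tail_class:
  assumes "q \<in> tail_class E p" "set w \<subseteq> lpa_gens E" "word_act E w q = Some q'"
  shows "q' \<in> tail_class E p"
  using assms(2,3)
  by (induction w arbitrary: q')
    (use assms(1) in \<open>auto simp: bind_eq_Some_conv intro: gen_act_tail_class\<close>)

lemma free_act_closed:
  assumes "a \<in> carrier (free_algebra (lpa_gens E))" "Poly_Mapping.keys x \<subseteq> tail_class E p"
  shows "Poly_Mapping.keys (free_act E a x) \<subseteq> tail_class E p"
proof -
  have "Poly_Mapping.keys (word_vec E w q c) \<subseteq> tail_class E p"
    if "w \<in> Poly_Mapping.keys a" "q \<in> Poly_Mapping.keys x" for w q c
    using that assms word_act_tail_class[of q E p "letters w"]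
    by (auto split: option.splits if_splits)
  then show ?thesis
    unfolding free_act_def by (intro order_trans[OF keys_sum] UN_least)
qed

lemma tail_class_arcs: "q \<in> tail_class E p \<Longrightarrow> q i \<in> arcs E"
  by (simp add: tail_class_def infinite_path_def)

lemma free_act_letter:
  "free_act E (letter g) (Poly_Mapping.single q c) = word_vec E (Word [g]) q c"
  "free_act E (letter g * letter h) (Poly_Mapping.single q c) = word_vec E (Word [g, h]) q c"
  by (auto simp: letter_def free_act_single mult_single plus_free_monoid_def split: option.split)

lemma case_nat_path_tail: "case_nat (q 0) (path_tail 1 q) = q"
  by (auto simp: path_tail_def fun_eq_iff split: nat.split)

lemma free_act_relation_single:
  assumes "r \<in> lpa_relations E" "q \<in> tail_class E p"
  shows "free_act E r (Poly_Mapping.single q c) = 0"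
proof -
  have q: "q i \<in> arcs E" "head E (q i) = tail E (q (Suc i))" for i
    using assms(2) by (auto simp: tail_class_def infinite_path_def)
  have path_tail_0: "path_tail (Suc 0) q 0 = q (Suc 0)" by (simp add: path_tail_def)
  have ck2: "free_act E (\<Sum>e\<in>out_arcs E v. letter (Edge e) * letter (Ghost e))
        (Poly_Mapping.single q c) =
      (if v = tail E (q 0) then Poly_Mapping.single q c else 0)" if "finite (out_arcs E v)" for v
  proof -
    have "(\<Sum>e\<in>out_arcs E v. word_vec E (Word [Edge e, Ghost e]) q c) =
      (\<Sum>e\<in>out_arcs E v. if q 0 = e then Poly_Mapping.single q c else 0)"
    proof (rule sum.cong[OF refl])
      fix e
      have "case_nat e (path_tail (Suc 0) q) = q" if "e = q 0"
        using case_nat_path_tail[of q] that by simp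
      then show "word_vec E (Word [Edge e, Ghost e]) q c =
          (if q 0 = e then Poly_Mapping.single q c else 0)"
        using q by (auto simp: path_tail_0)
    qed
    also have "\<dots> = (if v = tail E (q 0) then Poly_Mapping.single q c else 0)"
      using that q by (auto simp: sum.delta')
    finally show ?thesis by (simp only: free_act_sum_left free_act_letter)
  qed
  have "path_tail (Suc 0) (case_nat f q) = q" for f
    by (auto simp: path_tail_def)
  then show ?thesis
    using assms(1) q unfolding lpa_relations_def
    by (auto simp: free_act_diff_left free_act_letter ck2 path_tail_def
        split: if_splits)
qed

lemma free_act_ideal:
  assumes "wf_digraph E" "a \<in> lpa_ideal E" "Poly_Mapping.keys x \<subseteq> tail_class E p"
  shows "free_act E (a :: _ \<Rightarrow>\<^sub>0 'k::field) x = 0"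
proof -
  let ?F = "free_algebra (lpa_gens E) :: (_ \<Rightarrow>\<^sub>0 'k) ring"
  interpret F: ring ?F by (rule ring_free_algebra)
  let ?J = "{a \<in> carrier ?F. \<forall>x. Poly_Mapping.keys x \<subseteq> tail_class E p \<longrightarrow> free_act E a x = 0}"
  have "ideal ?J ?F"
  proof (rule idealI[OF F.ring_axioms])
    show "subgroup ?J (add_monoid ?F)"
    proof (rule F.add.subgroupI)
      have "0 \<in> ?J" by simp
      then show "?J \<noteq> {}" by blast
      fix a assume a: "a \<in> ?J"
      then have "\<ominus>\<^bsub>?F\<^esub> a = - a"
        by (intro F.minus_equality) auto
      with a show "\<ominus>\<^bsub>?F\<^esub> a \<in> ?J" by (auto simp: free_act_minus_left)
      fix b assume "b \<in> ?J"
      with a show "a \<oplus>\<^bsub>?F\<^esub> b \<in> ?J"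
        using F.add.m_closed[of a b] by (simp add: free_act_add_left)
    qed auto
  next
    fix a b assume "a \<in> ?J" "b \<in> carrier ?F"
    then show "b \<otimes>\<^bsub>?F\<^esub> a \<in> ?J" "a \<otimes>\<^bsub>?F\<^esub> b \<in> ?J"
      using F.m_closed[of a b] F.m_closed[of b a] free_act_closed[of b E _ p]
      by (auto simp: free_act_mult)
  qed
  moreover have "lpa_relations E \<subseteq> ?J"
  proof
    fix r :: "_ \<Rightarrow>\<^sub>0 'k" assume r: "r \<in> lpa_relations E"
    have "free_act E r x = 0" if "Poly_Mapping.keys x \<subseteq> tail_class E p" for x
    proof (induction x rule: poly_mapping_add_induct)
      case (single q c)
      with that r show ?case by (auto intro: free_act_relation_single)
    qed (simp_all add: free_act_add_right)
    moreover have "r \<in> carrier ?F" using r lpa_relations_carrier[OF assms(1)] by blast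
    ultimately show "r \<in> ?J" by blast
  qed
  ultimately have "lpa_ideal E \<subseteq> ?J"
    unfolding lpa_ideal_def by (rule F.genideal_minimal)
  with assms show ?thesis by blast
qed

abbreviation lpa_class ::
  "('v, 'e) pre_digraph \<Rightarrow> (('v, 'e) lpa_gen free_monoid \<Rightarrow>\<^sub>0 'k::field) \<Rightarrow>
   (('v, 'e) lpa_gen free_monoid \<Rightarrow>\<^sub>0 'k) set" where
  "lpa_class E a \<equiv> a_r_coset (free_algebra (lpa_gens E)) (lpa_ideal E) a"

abbreviation lpa_reps ::
  "('v, 'e) pre_digraph \<Rightarrow> (('v, 'e) lpa_gen free_monoid \<Rightarrow>\<^sub>0 'k::field) set" where
  "lpa_reps E \<equiv> {a \<in> carrier (free_algebra (lpa_gens E)). Poly_Mapping.lookup a 0 = 0}"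

lemma carrier_lpa: "carrier (leavitt_path_algebra K E) = lpa_class E ` lpa_reps E"
  by (auto simp: leavitt_path_algebra_def)

lemma lpa_ops:
  fixes K :: "'k::field itself" and a b :: "('v, 'e) lpa_gen free_monoid \<Rightarrow>\<^sub>0 'k"
  assumes "wf_digraph E" "a \<in> carrier (free_algebra (lpa_gens E))"
    "b \<in> carrier (free_algebra (lpa_gens E))"
  shows "lpa_class E a \<otimes>\<^bsub>leavitt_path_algebra K E\<^esub> lpa_class E b = lpa_class E (a * b)"
    and "lpa_class E a \<oplus>\<^bsub>leavitt_path_algebra K E\<^esub> lpa_class E b = lpa_class E (a + b)"
    and "\<zero>\<^bsub>leavitt_path_algebra K E\<^esub> = lpa_class E 0"
proof -
  interpret I: ideal "lpa_ideal E :: (_ \<Rightarrow>\<^sub>0 'k) set" "free_algebra (lpa_gens E)"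
    by (rule ideal_lpa_ideal) fact
  show "lpa_class E a \<otimes>\<^bsub>leavitt_path_algebra K E\<^esub> lpa_class E b = lpa_class E (a * b)"
    using I.rcoset_mult_add[OF assms(2,3)]
    by (simp add: leavitt_path_algebra_def FactRing_def)
  show "lpa_class E a \<oplus>\<^bsub>leavitt_path_algebra K E\<^esub> lpa_class E b = lpa_class E (a + b)"
    using I.a_rcos_sum[OF assms(2,3)]
    by (simp add: leavitt_path_algebra_def FactRing_def)
  show "\<zero>\<^bsub>leavitt_path_algebra K E\<^esub> = lpa_class E 0"
    using I.a_coset_join2[OF I.zero_closed I.is_additive_subgroup[THEN additive_subgroup.a_subgroup]]
      additive_subgroup.zero_closed[OF I.is_additive_subgroup]
    by (simp only: leavitt_path_algebra_def FactRing_def ring.simps free_algebra_simps)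
      (simp add: FactRing_def)
qed

lemma lpa_reps_closed:
  assumes "a \<in> lpa_reps E" "b \<in> lpa_reps E"
  shows "a * b \<in> lpa_reps E" "a + b \<in> lpa_reps E" "- a \<in> lpa_reps E" "0 \<in> lpa_reps E"
proof -
  interpret F: ring "free_algebra (lpa_gens E)" by (rule ring_free_algebra)
  show "a * b \<in> lpa_reps E" "a + b \<in> lpa_reps E"
    using assms F.m_closed[of a b] F.add.m_closed[of a b]
    by (simp_all add: lookup_mult_0 lookup_add)
  show "- a \<in> lpa_reps E" "0 \<in> lpa_reps E" using assms by simp_all
qed

lemma nonunital_ring_lpa:
  assumes "wf_digraph E"
  shows "nonunital_ring (leavitt_path_algebra K E)"
proof -
  let ?L = "leavitt_path_algebra K E"
  note ops = lpa_ops[OF assms, of _ _ K]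
  note cl = lpa_reps_closed
  have C: "\<exists>a. A = lpa_class E a \<and> a \<in> lpa_reps E" if "A \<in> carrier ?L" for A
    using that by (auto simp: carrier_lpa)
  have M: "lpa_class E a \<in> carrier ?L" if "a \<in> lpa_reps E" for a
    using that by (auto simp: carrier_lpa)
  have mul: "lpa_class E a \<otimes>\<^bsub>?L\<^esub> lpa_class E b = lpa_class E (a * b)"
    and ad: "lpa_class E a \<oplus>\<^bsub>?L\<^esub> lpa_class E b = lpa_class E (a + b)"
    if "a \<in> lpa_reps E" "b \<in> lpa_reps E" for a b
    using ops that by blast+
  have z: "\<zero>\<^bsub>?L\<^esub> = lpa_class E 0" using ops(3)[of 0 0] by simp
  have z0: "0 \<in> lpa_reps E" by simp
  show ?thesis
  proof (intro nonunital_ring.intro nonunital_ring_axioms.intro abelian_groupI)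
    fix A B D assume "A \<in> carrier ?L" "B \<in> carrier ?L" "D \<in> carrier ?L"
    then obtain a b d where "A = lpa_class E a" "B = lpa_class E b" "D = lpa_class E d"
      and "a \<in> lpa_reps E" "b \<in> lpa_reps E" "d \<in> lpa_reps E" using C by meson
    note abd = this(1-3) and r = this(4-6)
    show "A \<oplus>\<^bsub>?L\<^esub> B \<oplus>\<^bsub>?L\<^esub> D = A \<oplus>\<^bsub>?L\<^esub> (B \<oplus>\<^bsub>?L\<^esub> D)"
      "A \<otimes>\<^bsub>?L\<^esub> B \<otimes>\<^bsub>?L\<^esub> D = A \<otimes>\<^bsub>?L\<^esub> (B \<otimes>\<^bsub>?L\<^esub> D)"
      "(A \<oplus>\<^bsub>?L\<^esub> B) \<otimes>\<^bsub>?L\<^esub> D = A \<otimes>\<^bsub>?L\<^esub> D \<oplus>\<^bsub>?L\<^esub> B \<otimes>\<^bsub>?L\<^esub> D"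
      "A \<otimes>\<^bsub>?L\<^esub> (B \<oplus>\<^bsub>?L\<^esub> D) = A \<otimes>\<^bsub>?L\<^esub> B \<oplus>\<^bsub>?L\<^esub> A \<otimes>\<^bsub>?L\<^esub> D"
      unfolding abd using r
      by (simp_all only: mul ad cl) (simp_all only: algebra_simps)
  next
    fix A B assume "A \<in> carrier ?L" "B \<in> carrier ?L"
    then obtain a b where "A = lpa_class E a" "B = lpa_class E b"
      and "a \<in> lpa_reps E" "b \<in> lpa_reps E" using C by meson
    note abd = this(1-2) and r = this(3-4)
    show "A \<oplus>\<^bsub>?L\<^esub> B \<in> carrier ?L" "A \<otimes>\<^bsub>?L\<^esub> B \<in> carrier ?L"
      "A \<oplus>\<^bsub>?L\<^esub> B = B \<oplus>\<^bsub>?L\<^esub> A"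
      unfolding abd using r cl[OF r] by (simp_all only: mul ad M add.commute)
  next
    fix A assume "A \<in> carrier ?L"
    then obtain a where a: "A = lpa_class E a" and r: "a \<in> lpa_reps E" using C by meson
    show "\<zero>\<^bsub>?L\<^esub> \<oplus>\<^bsub>?L\<^esub> A = A"
      unfolding a z using ad[OF z0 r] by (simp only: add_0)
    show "\<exists>B\<in>carrier ?L. B \<oplus>\<^bsub>?L\<^esub> A = \<zero>\<^bsub>?L\<^esub>"
      unfolding a z using cl(3)[OF r r] r
      by (intro bexI[of _ "lpa_class E (- a)"] M) (simp_all only: ad left_minus)
  next
    show "\<zero>\<^bsub>?L\<^esub> \<in> carrier ?L" unfolding z by (rule M[OF z0])
  qed
qed

lemma chen_smult:
  assumes "wf_digraph E" "a \<in> carrier (free_algebra (lpa_gens E))"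
    "x \<in> carrier (chen_module K E p)"
  shows "lpa_class E a \<odot>\<^bsub>chen_module K E p\<^esub> x = free_act E a x"
proof -
  interpret I: ideal "lpa_ideal E" "free_algebra (lpa_gens E)"
    by (rule ideal_lpa_ideal) fact
  have "(SOME b. b \<in> lpa_class E a) \<in> lpa_class E a"
    by (rule someI) (rule I.a_rcos_self[OF assms(2)])
  then obtain h where h: "h \<in> lpa_ideal E" "(SOME b. b \<in> lpa_class E a) = h + a"
    by (auto simp: a_r_coset_def r_coset_def)
  have "lpa_class E a \<odot>\<^bsub>chen_module K E p\<^esub> x = free_act E (SOME b. b \<in> lpa_class E a) x"
    by (simp add: chen_module_def)
  also have "\<dots> = free_act E a x"
    unfolding h(2) using assms h(1) by (simp add: free_act_add_left free_act_ideal[where p = p])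
  finally show ?thesis .
qed

theorem unital_left_module_chen_module:
  assumes "wf_digraph E"
  shows "unital_left_module (leavitt_path_algebra K E) (chen_module K E p)"
proof -
  let ?L = "leavitt_path_algebra K E" and ?V = "chen_module K E p"
  interpret wf_digraph E by fact
  interpret L: nonunital_ring ?L by (rule nonunital_ring_lpa) fact
  have V: "abelian_group ?V"
  proof (rule abelian_groupI)
    fix x y assume "x \<in> carrier ?V" "y \<in> carrier ?V"
    then show "x \<oplus>\<^bsub>?V\<^esub> y \<in> carrier ?V" using keys_add[of x y] by auto
  next
    fix x assume "x \<in> carrier ?V"
    then show "\<exists>y\<in>carrier ?V. y \<oplus>\<^bsub>?V\<^esub> x = \<zero>\<^bsub>?V\<^esub>"
      by (intro bexI[of _ "- x"]) auto
  qed (auto simp: add_ac)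
  interpret V: abelian_group ?V by (rule V)
  have C: "\<exists>a. A = lpa_class E a \<and> a \<in> lpa_reps E" if "A \<in> carrier ?L" for A
    using that by (auto simp: carrier_lpa)
  have sm: "lpa_class E a \<odot>\<^bsub>?V\<^esub> x = free_act E a x"
    if "a \<in> lpa_reps E" "x \<in> carrier ?V" for a x
    using chen_smult[OF assms] that by blast
  have cl: "free_act E a x \<in> carrier ?V" if "a \<in> lpa_reps E" "x \<in> carrier ?V" for a x
    using free_act_closed[of a E x p] that by simp
  have mul: "lpa_class E a \<otimes>\<^bsub>?L\<^esub> lpa_class E b = lpa_class E (a * b)"
    and ad: "lpa_class E a \<oplus>\<^bsub>?L\<^esub> lpa_class E b = lpa_class E (a + b)"
    if "a \<in> lpa_reps E" "b \<in> lpa_reps E" for a b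
    using lpa_ops[OF assms, of a b K] that by blast+
  have mod: "left_module ?L ?V"
  proof (intro left_module.intro left_module_axioms.intro L.nonunital_ring_axioms V)
    fix A x assume "A \<in> carrier ?L" and x: "x \<in> carrier ?V"
    then obtain a where a: "A = lpa_class E a" "a \<in> lpa_reps E" using C by meson
    then show "A \<odot>\<^bsub>?V\<^esub> x \<in> carrier ?V" using cl sm x by simp
    fix y assume y: "y \<in> carrier ?V"
    show "A \<odot>\<^bsub>?V\<^esub> (x \<oplus>\<^bsub>?V\<^esub> y) = A \<odot>\<^bsub>?V\<^esub> x \<oplus>\<^bsub>?V\<^esub> A \<odot>\<^bsub>?V\<^esub> y"
      using V.add.m_closed[OF x y] a x y by (simp only: sm) (simp add: free_act_add_right)
  next
    fix A B x assume "A \<in> carrier ?L" "B \<in> carrier ?L" and x: "x \<in> carrier ?V"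
    then obtain a b where ab: "A = lpa_class E a" "B = lpa_class E b"
      and r: "a \<in> lpa_reps E" "b \<in> lpa_reps E" using C by meson
    show "(A \<oplus>\<^bsub>?L\<^esub> B) \<odot>\<^bsub>?V\<^esub> x = A \<odot>\<^bsub>?V\<^esub> x \<oplus>\<^bsub>?V\<^esub> B \<odot>\<^bsub>?V\<^esub> x"
      unfolding ab using r x lpa_reps_closed[OF r]
      by (simp only: sm ad) (simp add: free_act_add_left)
    show "A \<otimes>\<^bsub>?L\<^esub> B \<odot>\<^bsub>?V\<^esub> x = A \<odot>\<^bsub>?V\<^esub> (B \<odot>\<^bsub>?V\<^esub> x)"
      unfolding ab using r x lpa_reps_closed[OF r]
      by (simp only: sm mul cl free_act_mult)
  qed
  let ?S = "{A \<odot>\<^bsub>?V\<^esub> x | A x. A \<in> carrier ?L \<and> x \<in> carrier ?V}"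
  have S: "?S \<subseteq> carrier ?V"
    using left_module.smult_closed[OF mod] by blast
  have "x \<in> generate (add_monoid ?V) ?S" if "x \<in> carrier ?V" for x
  proof (induction x rule: poly_mapping_add_induct)
    case zero
    show ?case using generate.one[of "add_monoid ?V" ?S] by simp
  next
    case (single q c)
    with that have q: "q \<in> tail_class E p" by auto
    then have "tail E (q 0) \<in> verts E" by (intro tail_in_verts tail_class_arcs)
    then have v: "letter (Vertex (tail E (q 0))) \<in> lpa_reps E"
      by (simp add: lpa_gens_def letter_def lookup_single zero_free_monoid_def)
    have s: "Poly_Mapping.single q c \<in> carrier ?V" using q by simp
    have "Poly_Mapping.single q c =
        lpa_class E (letter (Vertex (tail E (q 0)))) \<odot>\<^bsub>?V\<^esub> Poly_Mapping.single q c"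
      unfolding sm[OF v s] by (simp add: free_act_letter)
    then have "Poly_Mapping.single q c \<in> ?S"
      using v s by (auto simp only: carrier_lpa)
    then show ?case by (rule generate.incl)
  next
    case (add x y)
    then show ?case using generate.eng[of x "add_monoid ?V" ?S y] by simp
  qed
  moreover have "generate (add_monoid ?V) ?S \<subseteq> carrier ?V"
    using V.add.generate_incl[of ?S] S by simp
  ultimately have "generate (add_monoid ?V) ?S = carrier ?V" by blast
  with mod show ?thesis
    by (simp add: unital_left_module_def unital_left_module_axioms_def)
qed

end

theory Submission
  imports Defs
begin

text \<open>
  Write \<open>p\<^sub>n\<close> for the initial segment of \<open>p\<close> of length \<open>n\<close> and \<open>v\<close> for its source. Since \<open>p\<close> is
  irrational, distinct real paths \<open>\<gamma>\<close> ending at \<open>r(p\<^sub>n)\<close> give distinct infinite paths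
  \<open>\<gamma> \<tau>\<^bsub>>n\<^esub>(p)\<close>; hence \<open>a p = 0\<close> forces \<open>a p\<^sub>n = 0\<close> for large \<open>n\<close>, and the annihilator of \<open>p\<close> in
  \<open>L v\<close> is the union of the increasing chain of the left ideals generated by the idempotents
  \<open>v - p\<^sub>n p\<^sub>n\<^sup>*\<close>. As \<open>L v\<close> is projective, \<open>V\<close> is finitely presented if and only if this chain is
  eventually constant, i.e. the sequence \<open>p\<^sub>n p\<^sub>n\<^sup>*\<close> is. By (CK2) and because vertices are nonzero
  in \<open>L\<close>, its \<open>n\<close>-th step is an equality exactly when \<open>X\<^sub>n(p)\<close> is empty. In a finite graph a path
  without exits repeats an edge and is therefore periodic.
\<close>

section \<open>Modules over rings without identity\<close>

context nonunital_ring
begin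

lemma l_null: "a \<in> carrier R \<Longrightarrow> \<zero> \<otimes> a = \<zero>"
  using l_distr[of \<zero> \<zero> a] m_closed[of \<zero> a] add.r_cancel_one'[of "\<zero> \<otimes> a" "\<zero> \<otimes> a"]
  by simp

lemma r_null: "a \<in> carrier R \<Longrightarrow> a \<otimes> \<zero> = \<zero>"
  using r_distr[of a \<zero> \<zero>] m_closed[of a \<zero>] add.r_cancel_one'[of "a \<otimes> \<zero>" "a \<otimes> \<zero>"]
  by simp

lemma l_minus:
  assumes "a \<in> carrier R" "b \<in> carrier R"
  shows "(\<ominus> a) \<otimes> b = \<ominus> (a \<otimes> b)"
  using assms l_distr[of "\<ominus> a" a b]
  by (intro minus_equality[symmetric]) (simp_all add: m_closed l_neg l_null)

lemma r_minus:
  assumes "a \<in> carrier R" "b \<in> carrier R"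
  shows "a \<otimes> (\<ominus> b) = \<ominus> (a \<otimes> b)"
  using assms r_distr[of a "\<ominus> b" b]
  by (intro minus_equality[symmetric]) (simp_all add: m_closed l_neg r_null)

lemma left_module_left_ideal_sum:
  assumes e: "\<forall>i<n. e i \<in> carrier R"
  shows "left_module R (left_ideal_sum R n e)"
proof -
  let ?P = "left_ideal_sum R n e"
  have C: "x \<in> carrier ?P \<longleftrightarrow> x \<in> extensional {..<n} \<and> (\<forall>i<n. \<exists>a\<in>carrier R. x i = a \<otimes> e i)" for x
    by (auto simp: left_ideal_sum_def PiE_iff)
  have cl: "x i \<in> carrier R" if "x \<in> carrier ?P" "i < n" for x i
    using that e m_closed by (auto simp: C)
  have ops: "x \<oplus>\<^bsub>?P\<^esub> y = (\<lambda>i\<in>{..<n}. x i \<oplus> y i)"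
    "\<zero>\<^bsub>?P\<^esub> = (\<lambda>i\<in>{..<n}. \<zero>)" "a \<odot>\<^bsub>?P\<^esub> x = (\<lambda>i\<in>{..<n}. a \<otimes> x i)" for a x y
    by (simp_all add: left_ideal_sum_def)
  have "abelian_group ?P"
  proof (rule abelian_groupI)
    fix x y assume xy: "x \<in> carrier ?P" "y \<in> carrier ?P"
    have "\<exists>c\<in>carrier R. x i \<oplus> y i = c \<otimes> e i" if i: "i < n" for i
    proof -
      obtain a b where "a \<in> carrier R" "x i = a \<otimes> e i" "b \<in> carrier R" "y i = b \<otimes> e i"
        using xy i unfolding C by meson
      with e i show ?thesis by (intro bexI[of _ "a \<oplus> b"]) (auto simp: l_distr)
    qed
    then show "x \<oplus>\<^bsub>?P\<^esub> y \<in> carrier ?P" unfolding C by (auto simp: ops)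
    show "x \<oplus>\<^bsub>?P\<^esub> y = y \<oplus>\<^bsub>?P\<^esub> x"
      using xy cl by (auto simp: ops fun_eq_iff restrict_def intro!: add.m_comm)
    fix z assume "z \<in> carrier ?P"
    with xy show "x \<oplus>\<^bsub>?P\<^esub> y \<oplus>\<^bsub>?P\<^esub> z = x \<oplus>\<^bsub>?P\<^esub> (y \<oplus>\<^bsub>?P\<^esub> z)"
      using cl by (auto simp: ops fun_eq_iff restrict_def intro!: add.m_assoc)
  next
    show "\<zero>\<^bsub>?P\<^esub> \<in> carrier ?P"
      unfolding C using e l_null by (auto simp: ops intro!: bexI[of _ \<zero>])
  next
    fix x assume x: "x \<in> carrier ?P"
    have "(\<zero>\<^bsub>?P\<^esub> \<oplus>\<^bsub>?P\<^esub> x) i = x i" for i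
      using x[unfolded C] cl[OF x, of i] by (cases "i < n") (auto simp: ops extensional_def)
    then show "\<zero>\<^bsub>?P\<^esub> \<oplus>\<^bsub>?P\<^esub> x = x" ..
    have "\<exists>c\<in>carrier R. \<ominus> x i = c \<otimes> e i" if i: "i < n" for i
    proof -
      obtain a where "a \<in> carrier R" "x i = a \<otimes> e i" using x i unfolding C by meson
      with e i show ?thesis by (intro bexI[of _ "\<ominus> a"]) (auto simp: l_minus)
    qed
    then show "\<exists>y\<in>carrier ?P. y \<oplus>\<^bsub>?P\<^esub> x = \<zero>\<^bsub>?P\<^esub>"
      using cl[OF x] by (intro bexI[of _ "\<lambda>i\<in>{..<n}. \<ominus> x i"])
        (auto simp: C ops l_neg intro!: restrict_ext)
  qed
  moreover have "left_module_axioms R ?P"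
  proof
    fix a x assume a: "a \<in> carrier R" and x: "x \<in> carrier ?P"
    have "\<exists>c\<in>carrier R. a \<otimes> x i = c \<otimes> e i" if i: "i < n" for i
    proof -
      obtain b where "b \<in> carrier R" "x i = b \<otimes> e i" using x i unfolding C by meson
      with e i a show ?thesis by (intro bexI[of _ "a \<otimes> b"]) (auto simp: m_assoc m_closed)
    qed
    then show "a \<odot>\<^bsub>?P\<^esub> x \<in> carrier ?P" unfolding C by (auto simp: ops)
    fix b assume "b \<in> carrier R"
    with a show "(a \<oplus> b) \<odot>\<^bsub>?P\<^esub> x = a \<odot>\<^bsub>?P\<^esub> x \<oplus>\<^bsub>?P\<^esub> b \<odot>\<^bsub>?P\<^esub> x"
      "(a \<otimes> b) \<odot>\<^bsub>?P\<^esub> x = a \<odot>\<^bsub>?P\<^esub> (b \<odot>\<^bsub>?P\<^esub> x)"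
      using cl[OF x]
      by (auto simp: ops fun_eq_iff restrict_def l_distr m_assoc)
  next
    fix a x y assume "a \<in> carrier R" "x \<in> carrier ?P" "y \<in> carrier ?P"
    then show "a \<odot>\<^bsub>?P\<^esub> (x \<oplus>\<^bsub>?P\<^esub> y) = a \<odot>\<^bsub>?P\<^esub> x \<oplus>\<^bsub>?P\<^esub> a \<odot>\<^bsub>?P\<^esub> y"
      using cl by (auto simp: ops fun_eq_iff restrict_def r_distr)
  qed
  ultimately show ?thesis
    using nonunital_ring_axioms by (intro left_module.intro)
qed

end

section \<open>Submodules and kernels of linear maps\<close>

context left_module
begin

lemma smult_l_null: "x \<in> carrier M \<Longrightarrow> \<zero> \<odot>\<^bsub>M\<^esub> x = \<zero>\<^bsub>M\<^esub>"
  using smult_l_distr[of \<zero> \<zero> x] smult_closed[of \<zero> x]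
    M.add.r_cancel_one'[of "\<zero> \<odot>\<^bsub>M\<^esub> x" "\<zero> \<odot>\<^bsub>M\<^esub> x"]
  by simp

lemma smult_r_null: "a \<in> carrier R \<Longrightarrow> a \<odot>\<^bsub>M\<^esub> \<zero>\<^bsub>M\<^esub> = \<zero>\<^bsub>M\<^esub>"
  using smult_r_distr[of a "\<zero>\<^bsub>M\<^esub>" "\<zero>\<^bsub>M\<^esub>"] smult_closed[of a "\<zero>\<^bsub>M\<^esub>"]
    M.add.r_cancel_one'[of "a \<odot>\<^bsub>M\<^esub> \<zero>\<^bsub>M\<^esub>" "a \<odot>\<^bsub>M\<^esub> \<zero>\<^bsub>M\<^esub>"]
  by simp

lemma smult_l_minus:
  assumes "a \<in> carrier R" "x \<in> carrier M"
  shows "(\<ominus> a) \<odot>\<^bsub>M\<^esub> x = \<ominus>\<^bsub>M\<^esub> (a \<odot>\<^bsub>M\<^esub> x)"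
  using assms smult_l_distr[of "\<ominus> a" a x]
  by (intro M.minus_equality[symmetric]) (simp_all add: smult_closed R.l_neg smult_l_null)

lemma submoduleI:
  assumes "H \<subseteq> carrier M" "\<zero>\<^bsub>M\<^esub> \<in> H"
    and add: "\<And>x y. \<lbrakk>x \<in> H; y \<in> H\<rbrakk> \<Longrightarrow> x \<oplus>\<^bsub>M\<^esub> y \<in> H"
    and "\<And>x. x \<in> H \<Longrightarrow> \<ominus>\<^bsub>M\<^esub> x \<in> H"
    and smult: "\<And>a x. \<lbrakk>a \<in> carrier R; x \<in> H\<rbrakk> \<Longrightarrow> a \<odot>\<^bsub>M\<^esub> x \<in> H"
  shows "submodule H R M"
proof (intro submodule.intro submodule_axioms.intro)
  show "subgroup H (add_monoid M)"
    using assms by (intro M.add.subgroupI) auto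
qed (rule smult)

text \<open>Serves both for the kernel of a presentation and for the set of elements that a map into
  \<open>R\<close>, followed by right multiplication by an idempotent, sends to zero.\<close>

lemma submodule_kernel:
  assumes "\<And>x. x \<in> carrier M \<Longrightarrow> g x \<in> carrier N"
    and "\<And>x y. x \<in> carrier M \<Longrightarrow> y \<in> carrier M \<Longrightarrow> g (x \<oplus>\<^bsub>M\<^esub> y) = g x \<oplus>\<^bsub>N\<^esub> g y"
    and "\<And>a x. a \<in> carrier R \<Longrightarrow> x \<in> carrier M \<Longrightarrow> g (a \<odot>\<^bsub>M\<^esub> x) = a \<odot>\<^bsub>N\<^esub> g x"
    and "left_module R N"
  shows "submodule {x \<in> carrier M. g x = \<zero>\<^bsub>N\<^esub>} R M"
proof -
  interpret N: left_module R N by fact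
  have g0: "g \<zero>\<^bsub>M\<^esub> = \<zero>\<^bsub>N\<^esub>"
    using assms(2)[of "\<zero>\<^bsub>M\<^esub>" "\<zero>\<^bsub>M\<^esub>"] assms(1)[of "\<zero>\<^bsub>M\<^esub>"] N.M.add.r_cancel_one' by simp
  have gm: "g (\<ominus>\<^bsub>M\<^esub> x) = \<ominus>\<^bsub>N\<^esub> g x" if "x \<in> carrier M" for x
    using assms(2)[of "\<ominus>\<^bsub>M\<^esub> x" x] assms(1) that g0
    by (intro N.M.minus_equality[symmetric]) (simp_all add: M.l_neg)
  show ?thesis
    by (rule submoduleI) (auto simp: g0 gm assms N.smult_r_null smult_closed)
qed

end

lemma (in abelian_group) a_minus_eq_zero_iff:
  assumes "x \<in> carrier G" "y \<in> carrier G"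
  shows "x \<ominus> y = \<zero> \<longleftrightarrow> x = y"
  using assms by (metis a_minus_def add.inv_closed minus_equality minus_minus r_neg)

context nonunital_ring
begin

text \<open>With \<open>R\<close> as a left module over itself, lifts of a presentation to
  \<open>R\<close> become module homomorphisms.\<close>

definition regular_module :: "('a, 'a) module" where
  "regular_module =
     \<lparr>carrier = carrier R, mult = undefined, one = undefined, zero = \<zero>, add = (\<oplus>), smult = (\<otimes>)\<rparr>"

lemma left_module_regular_module: "left_module R regular_module"
proof (intro left_module.intro nonunital_ring_axioms left_module_axioms.intro)
  show "abelian_group regular_module"
    by (rule abelian_groupI)
      (auto simp: regular_module_def add.m_assoc intro: add.m_comm bexI[of _ "\<ominus> _"] l_neg)
qed (auto simp: regular_module_def m_closed l_distr r_distr m_assoc)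

end

context left_module
begin

text \<open>The left ideals \<open>R e\<^sub>i\<close> are projective, as the \<open>e\<^sub>i\<close> are idempotent.\<close>

lemma left_ideal_sum_lift:
  assumes e: "\<forall>i<n. e i \<in> carrier R \<and> e i \<otimes> e i = e i"
    and f: "f \<in> left_module_hom R (left_ideal_sum R n e) M"
    and x: "x \<in> carrier M" "\<And>y. y \<in> carrier M \<Longrightarrow> \<exists>a\<in>carrier R. a \<odot>\<^bsub>M\<^esub> x = y"
  obtains g where "g \<in> left_module_hom R (left_ideal_sum R n e) regular_module"
    and "\<And>s. s \<in> carrier (left_ideal_sum R n e) \<Longrightarrow> g s \<odot>\<^bsub>M\<^esub> x = f s"
proof -
  let ?P = "left_ideal_sum R n e"
  interpret P: left_module R ?P
    using e by (intro left_module_left_ideal_sum) blast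
  have C: "s \<in> carrier ?P \<longleftrightarrow> s \<in> extensional {..<n} \<and> (\<forall>i<n. \<exists>a\<in>carrier R. s i = a \<otimes> e i)" for s
    by (auto simp: left_ideal_sum_def PiE_iff)
  have cl: "s i \<in> carrier R" and unit: "s i \<otimes> e i = s i" if "s \<in> carrier ?P" "i < n" for s i
    using that e by (auto simp: C m_closed m_assoc)
  have f_cl: "f s \<in> carrier M"
    and f_smult: "a \<in> carrier R \<Longrightarrow> f (a \<odot>\<^bsub>?P\<^esub> s) = a \<odot>\<^bsub>M\<^esub> f s" if "s \<in> carrier ?P" for s a
    using f that by (auto simp: left_module_hom_def hom_def)
  have f_add: "f (s \<oplus>\<^bsub>?P\<^esub> t) = f s \<oplus>\<^bsub>M\<^esub> f t" if "s \<in> carrier ?P" "t \<in> carrier ?P" for s t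
    using f that by (auto simp: left_module_hom_def hom_def)
  \<comment> \<open>\<open>d i\<close> is the copy of \<open>e i\<close> in the summand with index
    \<open>i\<close>. Truncation after \<open>k\<close> coordinates allows induction over the
    summands.\<close>
  define d where "d i = (\<lambda>j\<in>{..<n}. if j = i then e i else \<zero>)" for i
  define trunc where "trunc k s = (\<lambda>j\<in>{..<n}. if j < k then s j else \<zero>)" for k :: nat and s
  have zero_in: "\<exists>a\<in>carrier R. \<zero> = a \<otimes> e i" if "i < n" for i
    using e that l_null by (intro bexI[of _ \<zero>]) auto
  have d: "d i \<in> carrier ?P" if "i < n" for i
    unfolding C d_def using e that zero_in by auto metis
  have trunc: "trunc k s \<in> carrier ?P" if "s \<in> carrier ?P" for k s
    using that zero_in unfolding C trunc_def by auto
  \<comment> \<open>Since \<open>x\<close> generates, some \<open>y i\<close> satisfies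
    \<open>y i x = f (d i)\<close>. The lift sends \<open>s\<close> to the sum of the products
    \<open>s i \<otimes> y i\<close>; \<open>g k\<close> is its part from the first \<open>k\<close>
    summands.\<close>
  have "\<exists>b\<in>carrier R. b \<odot>\<^bsub>M\<^esub> x = f (d i)" if "i < n" for i
    using x(2) f_cl d that by blast
  then obtain y where y: "\<And>i. i < n \<Longrightarrow> y i \<in> carrier R" "\<And>i. i < n \<Longrightarrow> y i \<odot>\<^bsub>M\<^esub> x = f (d i)"
    by metis
  define g where "g k s = finsum R (\<lambda>i. s i \<otimes> y i) {..<k}" for k s
  have g_Suc: "g (Suc k) s = s k \<otimes> y k \<oplus> g k s" if "s \<in> carrier ?P" "k < n" for k s
    unfolding g_def lessThan_Suc using that cl[OF that(1)] y(1)
    by (intro R.finsum_insert) (auto simp: m_closed)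
  have g_cl: "g k s \<in> carrier R" if "s \<in> carrier ?P" "k \<le> n" for k s
    unfolding g_def using that cl[OF that(1)] y(1) by (intro R.finsum_closed) (auto simp: m_closed)
  have g_0: "g 0 s = \<zero>" for s by (simp add: g_def)
  have g_add: "g k (s \<oplus>\<^bsub>?P\<^esub> t) = g k s \<oplus> g k t"
    if "s \<in> carrier ?P" "t \<in> carrier ?P" "k \<le> n" for k s t
    using that(3)
  proof (induction k)
    case (Suc k)
    have "(s \<oplus>\<^bsub>?P\<^esub> t) k = s k \<oplus> t k" using Suc.prems by (simp add: left_ideal_sum_def)
    with Suc that show ?case
      by (simp add: g_Suc cl y g_cl l_distr m_closed R.add.m_ac)
  qed (simp add: g_0)
  have g_smult: "g k (a \<odot>\<^bsub>?P\<^esub> s) = a \<otimes> g k s"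
    if "s \<in> carrier ?P" "a \<in> carrier R" "k \<le> n" for k s a
    using that(3)
  proof (induction k)
    case (Suc k)
    have "(a \<odot>\<^bsub>?P\<^esub> s) k = a \<otimes> s k" using Suc.prems by (simp add: left_ideal_sum_def)
    with Suc that show ?case
      by (simp add: g_Suc cl y g_cl r_distr m_closed m_assoc P.smult_closed)
  qed (simp add: g_0 r_null that)
  have f_trunc: "f (trunc k s) = g k s \<odot>\<^bsub>M\<^esub> x" if "s \<in> carrier ?P" "k \<le> n" for k s
    using that(2)
  proof (induction k)
    case 0
    have "trunc 0 s = \<zero>\<^bsub>?P\<^esub>" by (simp add: trunc_def left_ideal_sum_def)
    moreover have "f \<zero>\<^bsub>?P\<^esub> = \<zero>\<^bsub>M\<^esub>"
      using f_smult[OF P.M.zero_closed R.zero_closed] f_cl[OF P.M.zero_closed]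
      by (simp add: P.smult_l_null smult_l_null)
    ultimately show ?case by (simp add: g_0 smult_l_null x)
  next
    case (Suc k)
    \<comment> \<open>Idempotence of \<open>e k\<close> enters here: it gives
      \<open>s k \<otimes> e k = s k\<close>, so \<open>s k\<close> times the generator
      \<open>d k\<close> restores exactly the missing coordinate.\<close>
    have "trunc (Suc k) s = (s k \<odot>\<^bsub>?P\<^esub> d k) \<oplus>\<^bsub>?P\<^esub> trunc k s"
      using Suc.prems cl[OF that(1)] unit[OF that(1)]
      by (auto simp: trunc_def d_def left_ideal_sum_def fun_eq_iff restrict_def r_null less_Suc_eq)
    moreover have "s k \<in> carrier R" "y k \<in> carrier R" "g k s \<in> carrier R"
      "d k \<in> carrier ?P" "trunc k s \<in> carrier ?P" "k < n"
      using Suc.prems that cl y(1) g_cl d trunc by auto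
    ultimately show ?case
      using Suc.IH y(2)[of k] that x(1)
      by (simp add: g_Suc f_add f_smult P.smult_closed m_closed smult_l_distr smult_assoc)
  qed
  have "g n \<in> left_module_hom R ?P regular_module"
    using g_cl g_add g_smult by (auto simp: left_module_hom_def hom_def regular_module_def)
  moreover have "g n s \<odot>\<^bsub>M\<^esub> x = f s" if "s \<in> carrier ?P" for s
  proof -
    have "trunc n s = s" using that by (auto simp: C trunc_def extensional_def)
    with f_trunc[OF that order_refl] show ?thesis by simp
  qed
  ultimately show ?thesis using that by blast
qed

end

section \<open>A criterion for finite presentation of a cyclic module\<close>

text \<open>The assumptions make the annihilator of \<open>x\<close> in \<open>R v\<close> the union
  of the increasing chain of left ideals \<open>R (v - h n)\<close>. Given a finite presentation,
  lifting it to \<open>R\<close> turns the kernel generators into finitely many annihilators of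
  \<open>x\<close>, all killed by a single \<open>h m\<close>. Conversely, if the chain stops at
  \<open>N\<close>, then \<open>v - h N\<close> generates the kernel of the map from
  \<open>R v\<close> to \<open>M\<close> given by \<open>x\<close>.\<close>

lemma (in unital_left_module) finitely_presented_iff_eventually_constant:
  fixes h :: "nat \<Rightarrow> 'a"
  assumes v: "v \<in> carrier R" "v \<otimes> v = v"
    and x: "x \<in> carrier M" "v \<odot>\<^bsub>M\<^esub> x = x" "\<And>y. y \<in> carrier M \<Longrightarrow> \<exists>a\<in>carrier R. a \<odot>\<^bsub>M\<^esub> x = y"
    and h: "\<And>n. h n \<in> carrier R" "\<And>n. v \<otimes> h n = h n" "\<And>n. h n \<otimes> v = h n"
      "\<And>m n. m \<le> n \<Longrightarrow> h m \<otimes> h n = h n" "\<And>m n. m \<le> n \<Longrightarrow> h n \<otimes> h m = h n"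
      "\<And>n. h n \<odot>\<^bsub>M\<^esub> x = x"
    and ann: "\<And>a. a \<in> carrier R \<Longrightarrow> a \<odot>\<^bsub>M\<^esub> x = \<zero>\<^bsub>M\<^esub> \<Longrightarrow> \<exists>n. a \<otimes> h n = \<zero>"
  shows "finitely_presented R M \<longleftrightarrow> (\<exists>N. \<forall>n\<ge>N. h n = h N)"
proof
  have vh: "v \<ominus> h n \<in> carrier R" "(v \<ominus> h n) \<odot>\<^bsub>M\<^esub> x = \<zero>\<^bsub>M\<^esub>" for n
    using v x h by (simp_all add: a_minus_def smult_l_distr smult_l_minus M.r_neg)
  have ann_mono: "a \<otimes> h n = \<zero>" if "a \<in> carrier R" "a \<otimes> h m = \<zero>" "m \<le> n" for a m n
  proof -
    have "a \<otimes> h n = (a \<otimes> h m) \<otimes> h n" using that(1,3) h(1,4) by (metis m_assoc)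
    with that h l_null show ?thesis by simp
  qed
  {
    assume "finitely_presented R M"
    then obtain n e f where e: "\<forall>i<n. e i \<in> carrier R \<and> e i \<otimes> e i = e i"
      and f: "f \<in> left_module_hom R (left_ideal_sum R n e) M"
      and surj: "f ` carrier (left_ideal_sum R n e) = carrier M"
      and fg: "fg_submodule R (left_ideal_sum R n e) (a_kernel (left_ideal_sum R n e) M f)"
      by (auto simp: finitely_presented_def)
    let ?P = "left_ideal_sum R n e"
    interpret P: left_module R ?P
      using e by (intro left_module_left_ideal_sum) blast
    have ker: "a_kernel ?P M f = {s \<in> carrier ?P. f s = \<zero>\<^bsub>M\<^esub>}"
      by (simp add: a_kernel_def kernel_def)
    obtain g where g: "g \<in> left_module_hom R ?P regular_module"
      and gf: "\<And>s. s \<in> carrier ?P \<Longrightarrow> g s \<odot>\<^bsub>M\<^esub> x = f s"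
      using left_ideal_sum_lift[OF e f x(1,3)] by blast
    have g_cl: "g s \<in> carrier R"
      and g_smult: "a \<in> carrier R \<Longrightarrow> g (a \<odot>\<^bsub>?P\<^esub> s) = a \<otimes> g s" if "s \<in> carrier ?P" for s a
      using g that by (auto simp: left_module_hom_def hom_def regular_module_def)
    have g_add: "g (s \<oplus>\<^bsub>?P\<^esub> t) = g s \<oplus> g t" if "s \<in> carrier ?P" "t \<in> carrier ?P" for s t
      using g that by (auto simp: left_module_hom_def hom_def regular_module_def)
    obtain S where S: "finite S" "S \<subseteq> a_kernel ?P M f"
      "\<And>N. submodule N R ?P \<Longrightarrow> S \<subseteq> N \<Longrightarrow> a_kernel ?P M f \<subseteq> N"
      using fg by (auto simp: fg_submodule_def)
    have "\<forall>s\<in>S. \<exists>m. g s \<otimes> h m = \<zero>"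
      using S(2) gf g_cl by (auto simp: ker intro!: ann)
    then obtain k where k: "\<And>s. s \<in> S \<Longrightarrow> g s \<otimes> h (k s) = \<zero>" by metis
    \<comment> \<open>A preimage \<open>z\<close> of \<open>x\<close> has a lift \<open>g z\<close>
      that agrees with \<open>v\<close> on \<open>x\<close>, so the difference
      \<open>v - g z\<close> is also killed by some \<open>h l\<close>.\<close>
    obtain z where z: "z \<in> carrier ?P" "f z = x" using surj x(1) by (metis imageE)
    have vz: "v \<ominus> g z \<in> carrier R" using v g_cl z by simp
    have "(v \<ominus> g z) \<odot>\<^bsub>M\<^esub> x = \<zero>\<^bsub>M\<^esub>"
      using v x g_cl z gf by (simp add: a_minus_def smult_l_distr smult_l_minus M.r_neg)
    then obtain l where l: "(v \<ominus> g z) \<otimes> h l = \<zero>" using ann vz by blast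
    \<comment> \<open>One index serves for all kernel generators and for \<open>v - g z\<close>; by
      \<open>ann_mono\<close> it may be larger than necessary for each of them.\<close>
    define m where "m = Max (insert l (k ` S))"
    have "submodule {s \<in> carrier ?P. g s \<otimes> h m = \<zero>\<^bsub>regular_module\<^esub>} R ?P"
      using h(1) g_cl g_add g_smult
      by (intro P.submodule_kernel left_module_regular_module)
        (auto simp: regular_module_def m_closed l_distr m_assoc)
    moreover have "S \<subseteq> {s \<in> carrier ?P. g s \<otimes> h m = \<zero>\<^bsub>regular_module\<^esub>}"
    proof
      fix s assume s: "s \<in> S"
      then have "s \<in> carrier ?P" using S(2) ker by blast
      moreover have "k s \<le> m" using S(1) s by (simp add: m_def)
      ultimately show "s \<in> {s \<in> carrier ?P. g s \<otimes> h m = \<zero>\<^bsub>regular_module\<^esub>}"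
        using ann_mono[OF g_cl k[OF s]] by (simp add: regular_module_def)
    qed
    ultimately have ker_ann: "g s \<otimes> h m = \<zero>" if "s \<in> carrier ?P" "f s = \<zero>\<^bsub>M\<^esub>" for s
      using S(3)[of "{s \<in> carrier ?P. g s \<otimes> h m = \<zero>\<^bsub>regular_module\<^esub>}"] that
      by (auto simp: regular_module_def ker)
    have "(v \<ominus> g z) \<otimes> h m = \<zero>"
      using S(1) by (intro ann_mono[OF vz l]) (simp add: m_def)
    then have hz: "g z \<otimes> h m = h m"
      using v h(1,2) g_cl[OF z(1)] R.a_minus_eq_zero_iff[of "h m" "g z \<otimes> h m"]
      by (simp add: a_minus_def l_distr l_minus m_closed)
    \<comment> \<open>Since \<open>v - h n\<close> annihilates \<open>x\<close>, the element
      \<open>(v - h n) z\<close> lies in the kernel of \<open>f\<close>. Its lift times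
      \<open>h m\<close> is \<open>(v - h n) (g z) (h m) = (v - h n) (h m) = h m - h n\<close>,
      which therefore vanishes.\<close>
    have "h n = h m" if "n \<ge> m" for n
    proof -
      let ?b = "v \<ominus> h n"
      have b: "?b \<odot>\<^bsub>?P\<^esub> z \<in> carrier ?P" using vh z P.smult_closed by blast
      have "f (?b \<odot>\<^bsub>?P\<^esub> z) = \<zero>\<^bsub>M\<^esub>"
        using f z vh by (simp add: left_module_hom_def)
      then have "g (?b \<odot>\<^bsub>?P\<^esub> z) \<otimes> h m = \<zero>" using ker_ann b by blast
      then have "?b \<otimes> h m = \<zero>"
        using vh z h(1) g_cl hz by (simp add: g_smult m_assoc)
      then have "h m \<ominus> h n = \<zero>"
        using v h that by (simp add: a_minus_def l_distr l_minus)
      then show "h n = h m" using h(1)[of n] h(1)[of m] R.a_minus_eq_zero_iff by metis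
    qed
    then show "\<exists>N. \<forall>n\<ge>N. h n = h N" by blast
  }
  assume "\<exists>N. \<forall>n\<ge>N. h n = h N"
  then obtain N where N: "\<And>n. n \<ge> N \<Longrightarrow> h n = h N" by blast
  \<comment> \<open>For the converse the presentation is \<open>R v\<close>, as a sum with one
    summand, mapped onto \<open>M\<close> by acting on \<open>x\<close>.\<close>
  define P where "P = left_ideal_sum R 1 (\<lambda>_. v)"
  interpret P: left_module R P
    unfolding P_def using v by (intro left_module_left_ideal_sum) blast
  have C: "s \<in> carrier P \<longleftrightarrow> s \<in> extensional {0} \<and> s 0 \<in> carrier R \<and> s 0 \<otimes> v = s 0" for s
    using v by (auto simp: P_def left_ideal_sum_def PiE_iff lessThan_Suc m_closed m_assoc
        intro: exI[of _ "s 0"])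
  have P_add: "(s \<oplus>\<^bsub>P\<^esub> t) 0 = s 0 \<oplus> t 0" and P_smult: "(a \<odot>\<^bsub>P\<^esub> s) 0 = a \<otimes> s 0" for a s t
    by (simp_all add: P_def left_ideal_sum_def)
  have P_eqI: "s = t" if "s \<in> carrier P" "t \<in> carrier P" "s 0 = t 0" for s t
    using that by (auto simp: C intro: extensionalityI)
  let ?f = "\<lambda>s :: nat \<Rightarrow> 'a. s 0 \<odot>\<^bsub>M\<^esub> x"
  have f: "?f \<in> left_module_hom R P M"
    using x(1)
    by (auto simp: left_module_hom_def hom_def C P_add P_smult smult_closed smult_l_distr smult_assoc)
  have surj: "?f ` carrier P = carrier M"
  proof (intro equalityI subsetI)
    fix y assume "y \<in> carrier M"
    then obtain a where "a \<in> carrier R" "a \<odot>\<^bsub>M\<^esub> x = y" using x(3) by blast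
    moreover define t where "t = (\<lambda>i\<in>{0 :: nat}. a \<otimes> v)"
    ultimately have "t \<in> carrier P" "y = ?f t"
      using v x(1,2) by (simp_all add: C smult_assoc m_assoc m_closed)
    then show "y \<in> ?f ` carrier P" by blast
  next
    fix y assume "y \<in> ?f ` carrier P"
    then show "y \<in> carrier M" using x(1) by (auto simp: C smult_closed)
  qed
  have ker: "a_kernel P M ?f = {s \<in> carrier P. ?f s = \<zero>\<^bsub>M\<^esub>}"
    by (simp add: a_kernel_def kernel_def)
  let ?s = "\<lambda>i\<in>{0 :: nat}. v \<ominus> h N"
  have "(v \<ominus> h N) \<otimes> v = v \<ominus> h N"
    using v h by (simp add: a_minus_def l_distr l_minus)
  then have s: "?s \<in> a_kernel P M ?f"
    using vh by (simp add: ker C)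
  have "fg_submodule R P (a_kernel P M ?f)"
    unfolding fg_submodule_def
  proof (intro conjI exI[of _ "{?s}"] allI impI)
    show "submodule (a_kernel P M ?f) R P"
      unfolding ker using f
      by (intro P.submodule_kernel left_module_axioms)
        (auto simp: left_module_hom_def hom_def)
  next
    fix N' assume N': "submodule N' R P" "{?s} \<subseteq> N'"
    show "a_kernel P M ?f \<subseteq> N'"
    proof
      fix t assume "t \<in> a_kernel P M ?f"
      then have t: "t \<in> carrier P" "t 0 \<odot>\<^bsub>M\<^esub> x = \<zero>\<^bsub>M\<^esub>" by (auto simp: ker)
      then obtain n where n: "t 0 \<otimes> h n = \<zero>" using ann C by blast
      \<comment> \<open>Passing to \<open>max n N\<close> and using constancy from \<open>N\<close>
        on covers both orders of \<open>n\<close> and \<open>N\<close>. Then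
        \<open>t 0 = t 0 (v - h N)\<close> exhibits \<open>t\<close> as a multiple of
        \<open>?s\<close>.\<close>
      have "t 0 \<otimes> h N = \<zero>"
        using ann_mono[OF _ n, of "max n N"] N[of "max n N"] t(1) C by simp
      then have "t 0 \<otimes> (v \<ominus> h N) = t 0"
        using t(1) C v h by (simp add: a_minus_def r_distr r_minus)
      then have "t = t 0 \<odot>\<^bsub>P\<^esub> ?s"
        using t(1) s by (intro P_eqI P.smult_closed) (auto simp: ker C P_smult)
      also have "\<dots> \<in> N'"
        using N' t(1) C by (intro submodule.smult_closed) auto
      finally show "t \<in> N'" .
    qed
  qed (use s in auto)
  then show "finitely_presented R M"
    unfolding finitely_presented_def using v f surj unital_left_module_axioms unfolding P_def
    by - (rule conjI, assumption, rule exI[of _ 1], rule exI[of _ "\<lambda>_. v"], rule exI[of _ ?f],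
      intro conjI allI impI; assumption)
qed

section \<open>Vertices are nonzero in the Leavitt path algebra\<close>

lemma free_algebra_minus:
  fixes a b :: "'g free_monoid \<Rightarrow>\<^sub>0 'k::field"
  assumes "b \<in> carrier (free_algebra X)"
  shows "a \<ominus>\<^bsub>free_algebra X\<^esub> b = a - b"
proof -
  interpret F: ring "free_algebra X :: ('g free_monoid \<Rightarrow>\<^sub>0 'k) ring" by (rule ring_free_algebra)
  have "\<ominus>\<^bsub>free_algebra X\<^esub> b = - b" using assms by (intro F.minus_equality) auto
  then show ?thesis by (simp add: a_minus_def)
qed

text \<open>
  A vertex from which an infinite path starts acts nontrivially on a Chen module. For the other
  vertices, which lead to a sink \<open>t\<close>, we let the algebra act on the walks ending in \<open>t\<close>; \<open>dual_act\<close>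
  is the induced (right) action on scalar functions of such walks.
\<close>

definition walk_start :: "('v, 'e) pre_digraph \<Rightarrow> 'v \<Rightarrow> 'e list \<Rightarrow> 'v" where
  "walk_start E t l = (case l of [] \<Rightarrow> t | e # _ \<Rightarrow> tail E e)"

fun sink_act :: "('v, 'e) pre_digraph \<Rightarrow> 'v \<Rightarrow> ('v, 'e) lpa_gen \<Rightarrow> 'e list \<Rightarrow> 'e list option"
where
  "sink_act E t (Vertex v) l = (if v = walk_start E t l then Some l else None)"
| "sink_act E t (Edge e) l = (if head E e = walk_start E t l then Some (e # l) else None)"
| "sink_act E t (Ghost e) l = (case l of [] \<Rightarrow> None | f # l' \<Rightarrow> if e = f then Some l' else None)"

primrec sink_word_act ::
  "('v, 'e) pre_digraph \<Rightarrow> 'v \<Rightarrow> ('v, 'e) lpa_gen list \<Rightarrow> 'e list \<Rightarrow> 'e list option"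
where
  "sink_word_act E t [] l = Some l"
| "sink_word_act E t (g # w) l = Option.bind (sink_word_act E t w l) (sink_act E t g)"

definition dual_act ::
  "('v, 'e) pre_digraph \<Rightarrow> 'v \<Rightarrow> (('v, 'e) lpa_gen free_monoid \<Rightarrow>\<^sub>0 'k::field) \<Rightarrow>
   ('e list \<Rightarrow> 'k) \<Rightarrow> 'e list \<Rightarrow> 'k"
where
  "dual_act E t a \<phi> l = (\<Sum>w\<in>Poly_Mapping.keys a. Poly_Mapping.lookup a w *
     (case sink_word_act E t (letters w) l of None \<Rightarrow> 0 | Some l' \<Rightarrow> \<phi> l'))"

lemma sink_word_act_append:
  "sink_word_act E t (v @ w) l = Option.bind (sink_word_act E t w l) (sink_word_act E t v)"
  by (induction v) (auto split: Option.bind_split)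

lemma dual_act_superset:
  assumes "finite A" "Poly_Mapping.keys a \<subseteq> A"
  shows "dual_act E t a \<phi> l = (\<Sum>w\<in>A. Poly_Mapping.lookup a w *
     (case sink_word_act E t (letters w) l of None \<Rightarrow> 0 | Some l' \<Rightarrow> \<phi> l'))"
  unfolding dual_act_def using assms by (intro sum.mono_neutral_left) (auto simp: in_keys_iff)

lemma dual_act_add: "dual_act E t (a + b) \<phi> l = dual_act E t a \<phi> l + dual_act E t b \<phi> l"
proof -
  let ?A = "Poly_Mapping.keys a \<union> Poly_Mapping.keys b"
  have "Poly_Mapping.keys (a + b) \<subseteq> ?A" by (rule keys_add)
  then show ?thesis
    by (simp add: dual_act_superset[of ?A] lookup_add distrib_right sum.distrib)
qed

lemma dual_act_0 [simp]: "dual_act E t 0 \<phi> l = 0"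
  by (simp add: dual_act_def)

lemma dual_act_uminus: "dual_act E t (- a) \<phi> l = - dual_act E t a \<phi> l"
  using dual_act_add[of E t "- a" a \<phi> l] by (simp add: eq_neg_iff_add_eq_0)

lemma dual_act_diff: "dual_act E t (a - b) \<phi> l = dual_act E t a \<phi> l - dual_act E t b \<phi> l"
  using dual_act_add[of E t a "- b" \<phi> l] by (simp add: dual_act_uminus)

lemma dual_act_sum: "dual_act E t (\<Sum>i\<in>I. g i) \<phi> l = (\<Sum>i\<in>I. dual_act E t (g i) \<phi> l)"
  by (induction I rule: infinite_finite_induct) (auto simp: dual_act_add)

lemma dual_act_add_right:
  "dual_act E t a (\<lambda>l. \<phi> l + \<psi> l) l = dual_act E t a \<phi> l + dual_act E t a \<psi> l"
  by (auto simp: dual_act_def sum.distrib[symmetric] distrib_left intro!: sum.cong split: option.split)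

lemma dual_act_zero_right: "dual_act E t a (\<lambda>_. 0) l = 0"
  by (auto simp: dual_act_def intro!: sum.neutral split: option.split)

lemma dual_act_single:
  "dual_act E t (Poly_Mapping.single w c) \<phi> l =
     c * (case sink_word_act E t (letters w) l of None \<Rightarrow> 0 | Some l' \<Rightarrow> \<phi> l')"
  by (subst dual_act_superset[of "{w}"]) auto

text \<open>Pulling functions back reverses the order of factors: the value of \<open>\<phi>\<close>
  at \<open>a (b l)\<close> is the value of \<open>dual_act E t a \<phi>\<close> at
  \<open>b l\<close>.\<close>

lemma dual_act_mult: "dual_act E t (a * b) \<phi> l = dual_act E t b (dual_act E t a \<phi>) l"
proof (induction a rule: poly_mapping_add_induct)
  case zero
  show ?case by (auto simp: dual_act_def intro!: sum.neutral split: option.split)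
next
  case (single v c)
  show ?case
  proof (induction b rule: poly_mapping_add_induct)
    case (single w d)
    show ?case
      by (simp add: mult_single dual_act_single plus_free_monoid_def sink_word_act_append mult_ac
          split: option.split)
  qed (simp_all add: dual_act_add distrib_left)
next
  case (add x y)
  have "dual_act E t (x + y) \<phi> = (\<lambda>l. dual_act E t x \<phi> l + dual_act E t y \<phi> l)"
    by (simp add: fun_eq_iff dual_act_add)
  with add show ?case by (simp add: distrib_right dual_act_add dual_act_add_right)
qed

lemma dual_act_letter:
  "dual_act E t (letter g) \<phi> l =
     (case sink_word_act E t [g] l of None \<Rightarrow> 0 | Some l' \<Rightarrow> \<phi> l')"
  "dual_act E t (letter g * letter h) \<phi> l =
     (case sink_word_act E t [g, h] l of None \<Rightarrow> 0 | Some l' \<Rightarrow> \<phi> l')"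
  by (simp_all add: letter_def dual_act_single mult_single plus_free_monoid_def)

section \<open>Walks into a sink and the elements acting on them as zero\<close>

context wf_digraph
begin

definition walks_to :: "'a \<Rightarrow> 'b list set" where
  "walks_to t = {l. \<exists>u. awalk u l t}"

lemma walks_to_start: "l \<in> walks_to t \<longleftrightarrow> awalk (walk_start G t l) l t"
  by (auto simp: walks_to_def walk_start_def awalk_Cons_iff awalk_def split: list.splits)

text \<open>The start of a walk is determined by its edges, or is \<open>t\<close> for the empty
  walk, so walks can be extended without recording their source.\<close>

lemma walks_to_Cons:
  "e # l \<in> walks_to t \<longleftrightarrow> e \<in> arcs G \<and> head G e = walk_start G t l \<and> l \<in> walks_to t"
proof -
  have "e # l \<in> walks_to t \<longleftrightarrow> e \<in> arcs G \<and> awalk (head G e) l t"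
    by (auto simp: walks_to_def awalk_Cons_iff)
  moreover have "u = walk_start G t l" if "awalk u l t" for u
    using that by (auto simp: walk_start_def awalk_Cons_iff split: list.splits)
  ultimately show ?thesis by (metis walks_to_start)
qed

lemma sink_act_walks_to:
  "l \<in> walks_to t \<Longrightarrow> g \<in> lpa_gens G \<Longrightarrow> sink_act G t g l = Some l' \<Longrightarrow> l' \<in> walks_to t"
  by (cases g) (auto simp: walks_to_Cons lpa_gens_def split: if_splits list.splits)

lemma sink_word_act_walks_to:
  assumes "l \<in> walks_to t" "set w \<subseteq> lpa_gens G" "sink_word_act G t w l = Some l'"
  shows "l' \<in> walks_to t"
  using assms(2,3) by (induction w arbitrary: l')
    (use assms(1) in \<open>auto simp: bind_eq_Some_conv intro: sink_act_walks_to\<close>)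

text \<open>The delicate relation is (CK2). On a nonempty walk only the summand of its first edge
  survives. On the empty walk all summands vanish, and so does the vertex, because \<open>t\<close>
  is a sink and (CK2) is imposed only at vertices that emit edges.\<close>

lemma dual_act_relation:
  fixes r :: "_ \<Rightarrow>\<^sub>0 'k::field"
  assumes "r \<in> lpa_relations G" "l \<in> walks_to t" "out_arcs G t = {}"
  shows "dual_act G t r \<phi> l = 0"
proof -
  have ck2: "dual_act G t (\<Sum>e\<in>out_arcs G v. letter (Edge e) * letter (Ghost e)) \<phi> l =
      (if v = walk_start G t l then \<phi> l else 0)"
    if v: "finite (out_arcs G v)" "out_arcs G v \<noteq> {}" for v
  proof (cases l)
    case Nil
    with v assms(3) show ?thesis
      by (auto simp: dual_act_sum dual_act_letter walk_start_def)
  next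
    case (Cons f l')
    have "dual_act G t (\<Sum>e\<in>out_arcs G v. letter (Edge e) * letter (Ghost e)) \<phi> l =
      (\<Sum>e\<in>out_arcs G v. if f = e then \<phi> l else 0)"
      unfolding dual_act_sum dual_act_letter using Cons assms(2)
      by (intro sum.cong refl) (auto simp: walks_to_Cons)
    also have "\<dots> = (if v = walk_start G t l then \<phi> l else 0)"
      using v(1) Cons assms(2) by (auto simp: sum.delta' walk_start_def walks_to_Cons)
    finally show ?thesis .
  qed
  have "head G f = walk_start G t l'" if "l = f # l'" for f l'
    using assms(2) that by (simp add: walks_to_Cons)
  then show ?thesis
    using assms(1) unfolding lpa_relations_def
    by (auto simp: dual_act_diff dual_act_letter ck2 walk_start_def
        split: if_splits list.splits)
qed

text \<open>The elements that act as zero on all functions, evaluated at walks to \<open>t\<close>,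
  form a two-sided ideal containing the relations.\<close>

lemma dual_act_ideal:
  fixes a :: "_ \<Rightarrow>\<^sub>0 'k::field"
  assumes t: "out_arcs G t = {}" and a: "a \<in> lpa_ideal G" and l: "l \<in> walks_to t"
  shows "dual_act G t a \<phi> l = 0"
proof -
  let ?F = "free_algebra (lpa_gens G) :: (_ \<Rightarrow>\<^sub>0 'k) ring"
  interpret F: ring ?F by (rule ring_free_algebra)
  let ?J = "{a \<in> carrier ?F. \<forall>\<phi>. \<forall>l\<in>walks_to t. dual_act G t a \<phi> l = 0}"
  \<comment> \<open>The action sees only the values of a function on walks to \<open>t\<close>. This
    is needed for the product \<open>a \<otimes> b\<close>, since
    \<open>dual_act G t a \<phi>\<close> is known to vanish on such walks only.\<close>
  have cong: "dual_act G t b \<phi> l = dual_act G t b \<psi> l"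
    if "b \<in> carrier ?F" "\<And>l. l \<in> walks_to t \<Longrightarrow> \<phi> l = \<psi> l" "l \<in> walks_to t"
    for b :: "_ \<Rightarrow>\<^sub>0 'k" and \<phi> \<psi> l
    unfolding dual_act_def using that sink_word_act_walks_to[of l t]
    by (intro sum.cong refl) (auto split: option.split)
  have "ideal ?J ?F"
  proof (rule idealI[OF F.ring_axioms])
    show "subgroup ?J (add_monoid ?F)"
    proof (rule F.add.subgroupI)
      have "0 \<in> ?J" by simp
      then show "?J \<noteq> {}" by blast
      fix a assume a: "a \<in> ?J"
      then have "\<ominus>\<^bsub>?F\<^esub> a = - a"
        by (intro F.minus_equality) auto
      with a show "\<ominus>\<^bsub>?F\<^esub> a \<in> ?J" by (auto simp: dual_act_uminus)
      fix b assume "b \<in> ?J"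
      with a show "a \<oplus>\<^bsub>?F\<^esub> b \<in> ?J"
        using F.add.m_closed[of a b] by (simp add: dual_act_add)
    qed auto
  next
    fix a b assume a: "a \<in> ?J" and b: "b \<in> carrier ?F"
    have "dual_act G t a (dual_act G t b \<phi>) l = 0" if "l \<in> walks_to t" for \<phi> l
      using a that by blast
    moreover have "dual_act G t b (dual_act G t a \<phi>) l = 0" if "l \<in> walks_to t" for \<phi> l
      using cong[OF b, of "dual_act G t a \<phi>" "\<lambda>_. 0" l] a that
      by (simp add: dual_act_zero_right)
    ultimately have "\<forall>\<phi>. \<forall>l\<in>walks_to t. dual_act G t (b \<otimes>\<^bsub>?F\<^esub> a) \<phi> l = 0"
      "\<forall>\<phi>. \<forall>l\<in>walks_to t. dual_act G t (a \<otimes>\<^bsub>?F\<^esub> b) \<phi> l = 0"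
      by (simp_all add: dual_act_mult)
    moreover have "b \<otimes>\<^bsub>?F\<^esub> a \<in> carrier ?F" "a \<otimes>\<^bsub>?F\<^esub> b \<in> carrier ?F"
      using a b F.m_closed by blast+
    ultimately show "b \<otimes>\<^bsub>?F\<^esub> a \<in> ?J" "a \<otimes>\<^bsub>?F\<^esub> b \<in> ?J"
      by blast+
  qed
  moreover have "lpa_relations G \<subseteq> ?J"
    using dual_act_relation[OF _ _ t] lpa_relations_carrier[OF wf_digraph_axioms] by blast
  ultimately have "lpa_ideal G \<subseteq> ?J"
    unfolding lpa_ideal_def by (rule F.genideal_minimal)
  with a l show ?thesis by blast
qed

text \<open>The set \<open>?Z\<close> of vertices in the ideal is closed under passing along edges
  and contains no sink. If it were nonempty, an infinite path would run inside it, and the first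
  vertex of that path would act both as zero and as the identity on the path.\<close>

lemma vertex_notin_lpa_ideal:
  assumes "v \<in> verts G"
  shows "(letter (Vertex v) :: _ \<Rightarrow>\<^sub>0 'k::field) \<notin> lpa_ideal G"
proof
  let ?F = "free_algebra (lpa_gens G) :: (_ \<Rightarrow>\<^sub>0 'k) ring"
  let ?I = "lpa_ideal G :: (_ \<Rightarrow>\<^sub>0 'k) set"
  interpret I: ideal ?I ?F by (rule ideal_lpa_ideal) (rule wf_digraph_axioms)
  let ?Z = "{v \<in> verts G. letter (Vertex v) \<in> ?I}"
  assume "letter (Vertex v) \<in> ?I"
  with assms have vZ: "v \<in> ?Z" by simp
  have rel: "r \<in> ?I" if "r \<in> lpa_relations G" for r
    unfolding lpa_ideal_def
    using that I.genideal_self[OF lpa_relations_carrier[OF wf_digraph_axioms]] by blast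
  have diff: "a - b \<in> ?I" if "a \<in> ?I" "b \<in> ?I" for a b
    using that additive_subgroup.a_closed[OF I.is_additive_subgroup, of a "\<ominus>\<^bsub>?F\<^esub> b"]
      additive_subgroup.a_inv_closed[OF I.is_additive_subgroup, of b]
      free_algebra_minus[of b _ a] I.a_subset
    by (auto simp: a_minus_def I.abelian_group_axioms)
  \<comment> \<open>For \<open>v\<close> the source of \<open>e\<close>, the relation (E2) puts the
    ghost edge of \<open>e\<close> into the ideal along with \<open>v\<close>; multiplying by
    \<open>e\<close> and applying (CK1) yields the range of \<open>e\<close>.\<close>
  have Z_head: "head G e \<in> ?Z" if "tail G e \<in> ?Z" "e \<in> arcs G" for e
  proof -
    let ?g = "letter (Ghost e) :: _ \<Rightarrow>\<^sub>0 'k" and ?e = "letter (Edge e) :: _ \<Rightarrow>\<^sub>0 'k"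
      and ?v = "letter (Vertex (tail G e)) :: _ \<Rightarrow>\<^sub>0 'k"
    have ge: "?g \<in> carrier ?F" "?e \<in> carrier ?F" using that by (auto simp: lpa_gens_def)
    have "?g * ?v \<in> ?I" using I.I_l_closed[of ?v ?g] that ge by simp
    moreover have "?g * ?v - ?g \<in> ?I" using that by (intro rel) (auto simp: lpa_relations_def)
    ultimately have "?g \<in> ?I" using diff[of "?g * ?v" "?g * ?v - ?g"] by simp
    then have "?g * ?e \<in> ?I" using I.I_r_closed[of ?g ?e] ge by simp
    moreover have "?g * ?e - letter (Vertex (head G e)) \<in> ?I"
      using that by (intro rel) (auto simp: lpa_relations_def)
    ultimately have "letter (Vertex (head G e)) \<in> ?I"
      using diff[of "?g * ?e" "?g * ?e - letter (Vertex (head G e))"] by simp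
    with that show ?thesis by simp
  qed
  \<comment> \<open>At a sink, the constant function 1 on the empty walk detects the vertex.\<close>
  have Z_out: "out_arcs G t \<noteq> {}" if "t \<in> ?Z" for t
  proof
    assume "out_arcs G t = {}"
    moreover have "[] \<in> walks_to t" using that by (auto simp: walks_to_def awalk_Nil_iff)
    ultimately have "dual_act G t (letter (Vertex t)) (\<lambda>_. 1 :: 'k) [] = 0"
      using that by (intro dual_act_ideal) auto
    then show False by (simp add: dual_act_letter walk_start_def)
  qed
  \<comment> \<open>Dependent choice of consecutive edges whose sources stay in
    \<open>?Z\<close>.\<close>
  have "\<exists>q. \<forall>n. (q n \<in> arcs G \<and> tail G (q n) \<in> ?Z) \<and> tail G (q (Suc n)) = head G (q n)"
  proof (intro dependent_nat_choice)
    show "\<exists>e. e \<in> arcs G \<and> tail G e \<in> ?Z" using Z_out[OF vZ] vZ by auto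
    fix e assume "e \<in> arcs G \<and> tail G e \<in> ?Z"
    then have e: "head G e \<in> ?Z" using Z_head by blast
    then obtain f where "f \<in> out_arcs G (head G e)" using Z_out by blast
    with e show "\<exists>f. (f \<in> arcs G \<and> tail G f \<in> ?Z) \<and> tail G f = head G e" by auto
  qed
  then obtain q where
    "\<forall>n. (q n \<in> arcs G \<and> tail G (q n) \<in> ?Z) \<and> tail G (q (Suc n)) = head G (q n)" ..
  then have q: "infinite_path G q" "tail G (q 0) \<in> ?Z" by (simp_all add: infinite_path_def)
  then have "q \<in> tail_class G q" by (auto simp: tail_class_def intro: tail_equivalentI)
  then have "free_act G (letter (Vertex (tail G (q 0)))) (Poly_Mapping.single q (1 :: 'k)) = 0"
    using q by (intro free_act_ideal[OF wf_digraph_axioms, of _ _ q]) auto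
  then have "Poly_Mapping.lookup (Poly_Mapping.single q (1 :: 'k)) q = 0" by (simp add: free_act_letter)
  then show False by simp
qed

end

section \<open>Irrational paths\<close>

lemma (in wf_digraph) awalk_infinite_path:
  assumes "infinite_path G p" "i \<le> j"
  shows "awalk (tail G (p i)) (map p [i..<j]) (tail G (p j))"
  using assms(2)
proof (induction j rule: dec_induct)
  case base
  then show ?case using assms(1) by (simp add: awalk_Nil_iff infinite_path_def)
next
  case (step j)
  then show ?case
    using assms(1) by (auto simp: infinite_path_def awalk_Cons_iff awalk_Nil_iff intro!: awalk_appendI)
qed

text \<open>From position \<open>i\<close> on, \<open>p\<close> has period \<open>j - i\<close>; the
  segment from \<open>i\<close> to \<open>j\<close> is the closed walk that is repeated.\<close>

lemma (in wf_digraph) rational_path_if_tails_eq: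
  assumes p: "infinite_path G p" and ij: "i < j" and eq: "path_tail i p = path_tail j p"
  shows "rational_path G p"
proof -
  let ?c = "map p [i..<j]"
  have shift: "p (j + k) = p (i + k)" for k using eq by (metis path_tail_def)
  have closed: "closed_w ?c"
    using awalk_infinite_path[OF p, of i j] ij shift[of 0] by (auto simp: closed_w_def)
  have "p (i + (k + m * (j - i))) = p (i + k)" for k m
  proof (induction m)
    case (Suc m)
    have "i + (k + Suc m * (j - i)) = j + (k + m * (j - i))" using ij by simp
    with Suc show ?case using shift[of "k + m * (j - i)"] by metis
  qed simp
  then have "p (i + k) = p (i + k mod (j - i))" for k by (metis mod_mult_div_eq mult.commute)
  moreover have "i + k mod (j - i) < j" for k
    using mod_less_divisor[of "j - i" k] ij by linarith
  ultimately have "path_tail i p = path_tail 0 (list_power_inf ?c)"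
    using ij by (simp add: path_tail_def list_power_inf_def fun_eq_iff)
  with closed show ?thesis using p by (auto simp: rational_path_def intro: tail_equivalentI)
qed

text \<open>By the pigeonhole principle some edge recurs beyond \<open>N\<close>. As every source
  there emits one edge only, both occurrences have the same continuation.\<close>

lemma (in fin_digraph) rational_path_if_eventually_no_exits:
  assumes p: "infinite_path G p" and N: "\<And>i. i \<ge> N \<Longrightarrow> path_exits G p i = {}"
  shows "rational_path G p"
proof -
  have "\<not> inj_on p {N..}"
  proof
    assume "inj_on p {N..}"
    moreover have "finite (p ` {N..})"
      using p by (intro finite_subset[OF _ finite_arcs]) (auto simp: infinite_path_def)
    ultimately show False using finite_imageD infinite_Ici by blast
  qed
  then obtain i j where ij: "N \<le> i" "i < j" "p i = p j"
    unfolding inj_on_def by (metis atLeast_iff linorder_neqE_nat order_trans less_imp_le)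
  have "p (i + k) = p (j + k)" for k
  proof (induction k)
    case (Suc k)
    then have "tail G (p (j + Suc k)) = tail G (p (i + Suc k))"
      using p by (metis add_Suc_right infinite_path_def)
    moreover have "p (j + Suc k) \<in> arcs G" using p by (simp add: infinite_path_def)
    ultimately show ?case using N[of "i + Suc k"] ij(1) by (auto simp: path_exits_def)
  qed (use ij in simp)
  then have "path_tail i p = path_tail j p" by (simp add: path_tail_def)
  with p ij(2) show ?thesis by (rule rational_path_if_tails_eq)
qed

section \<open>Finite paths prepended to a tail\<close>

definition conc_path :: "'e list \<Rightarrow> (nat \<Rightarrow> 'e) \<Rightarrow> nat \<Rightarrow> 'e" where
  "conc_path l q = (\<lambda>i. if i < length l then l ! i else q (i - length l))"

lemma conc_path_Nil [simp]: "conc_path [] q = q"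
  by (simp add: conc_path_def)

lemma conc_path_Cons: "conc_path (e # l) q = case_nat e (conc_path l q)"
  by (auto simp: conc_path_def fun_eq_iff split: nat.split)

text \<open>Comparing the two sides from position \<open>length l'\<close> on equates two different
  tails of \<open>p\<close>, which would make \<open>p\<close> rational.\<close>

lemma conc_path_inj_aux:
  assumes "wf_digraph E" "irrational_path E p"
    and eq: "conc_path l (path_tail n p) = conc_path l' (path_tail n p)"
    and len: "length l < length l'"
  shows False
proof -
  let ?d = "length l' - length l"
  have "path_tail (n + ?d) p = path_tail n p"
  proof
    fix i
    show "path_tail (n + ?d) p i = path_tail n p i"
      using fun_cong[OF eq, of "length l' + i"] len
      by (simp add: conc_path_def path_tail_def add_ac)
  qed
  then have "rational_path E p"
    using assms(2) len
    by (intro wf_digraph.rational_path_if_tails_eq[OF assms(1), of p n "n + ?d"])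
      (simp_all add: irrational_path_def)
  with assms(2) show False by (simp add: irrational_path_def)
qed

text \<open>Irrationality makes the finite prefix recoverable from the infinite path. This is what
  turns vectors of the Chen module back into elements of the algebra in
  \<open>annihilator_kills_path\<close>.\<close>

lemma conc_path_inj:
  assumes "wf_digraph E" "irrational_path E p"
    and eq: "conc_path l (path_tail n p) = conc_path l' (path_tail n p)"
  shows "l = l'"
proof -
  have "length l = length l'"
    using conc_path_inj_aux[OF assms(1,2) eq] conc_path_inj_aux[OF assms(1,2) eq[symmetric]]
    by (meson linorder_neqE_nat)
  moreover have "l ! i = l' ! i" if "i < length l" for i
    using fun_cong[OF eq, of i] that calculation by (simp add: conc_path_def)
  ultimately show ?thesis by (rule nth_equalityI)
qed

lemma conc_path_take: "conc_path (map p [0..<n]) (path_tail n p) = p"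
  by (auto simp: conc_path_def path_tail_def)

text \<open>The reversal is needed because the rightmost letter acts first and must remove the first
  edge.\<close>

lemma word_act_Ghost:
  "word_act E (map Ghost (rev (map p [0..<n]))) p = Some (path_tail n p)"
  by (induction n) (auto simp: path_tail_def)

lemma word_act_Edge:
  assumes "infinite_path E p" "i \<le> n"
  shows "word_act E (map Edge (map p [i..<n])) (path_tail n p) = Some (path_tail i p)"
  using assms(2)
proof (induction i rule: inc_induct)
  case (step i)
  have "map p [i..<n] = p i # map p [Suc i..<n]" using step by (simp add: upt_conv_Cons)
  moreover have "case_nat (p i) (path_tail (Suc i) p) = path_tail i p"
    by (auto simp: path_tail_def fun_eq_iff split: nat.split)
  ultimately show ?case using step assms(1) by (simp add: path_tail_def infinite_path_def)
qed simp

section \<open>Words in the Leavitt path algebra\<close>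

definition word_elt :: "'g list \<Rightarrow> ('g free_monoid \<Rightarrow>\<^sub>0 'k::field)" where
  "word_elt w = Poly_Mapping.single (Word w) 1"

lemma word_elt_append: "word_elt (v @ w) = word_elt v * word_elt w"
  by (simp add: word_elt_def mult_single plus_free_monoid_def)

lemma letter_eq_word_elt: "letter g = word_elt [g]"
  by (simp add: letter_def word_elt_def)

lemma word_elt_carrier: "set w \<subseteq> X \<Longrightarrow> word_elt w \<in> carrier (free_algebra X)"
  by (simp add: word_elt_def)

text \<open>Scalars belong to the unital free algebra, so a coefficient can be split off as a left
  factor and congruences of classes multiplied by it.\<close>

lemma single_eq_scalar_mult_word_elt:
  "Poly_Mapping.single w c = Poly_Mapping.single 0 c * word_elt (letters w)"
  by (simp add: word_elt_def mult_single)

locale leavitt = wf_digraph E for E :: "('v, 'e) pre_digraph" +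
  fixes K :: "'k::field itself"
begin

abbreviation F :: "(('v, 'e) lpa_gen free_monoid \<Rightarrow>\<^sub>0 'k) ring" where
  "F \<equiv> free_algebra (lpa_gens E)"

abbreviation L :: "(('v, 'e) lpa_gen free_monoid \<Rightarrow>\<^sub>0 'k) set ring" where
  "L \<equiv> leavitt_path_algebra K E"

definition cl :: "('v, 'e) lpa_gen list \<Rightarrow> (('v, 'e) lpa_gen free_monoid \<Rightarrow>\<^sub>0 'k) set" where
  "cl w = lpa_class E (word_elt w)"

sublocale L: nonunital_ring L
  by (rule nonunital_ring_lpa) (rule wf_digraph_axioms)

sublocale F: ring F
  by (rule ring_free_algebra)

lemmas mult_class = lpa_ops(1)[OF wf_digraph_axioms, of _ _ K]
  and add_class = lpa_ops(2)[OF wf_digraph_axioms, of _ _ K]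

lemma zero_class: "\<zero>\<^bsub>L\<^esub> = lpa_class E 0"
  by (rule lpa_ops(3)[OF wf_digraph_axioms, of 0 0 K]) auto

lemma class_eq_iff:
  assumes "a \<in> carrier F" "b \<in> carrier F"
  shows "lpa_class E a = lpa_class E b \<longleftrightarrow> a - b \<in> lpa_ideal E"
  using F.quotient_eq_iff_same_a_r_cos[OF ideal_lpa_ideal[OF wf_digraph_axioms] assms]
    free_algebra_minus[OF assms(2), of a] by simp

lemma class_closed: "a \<in> lpa_reps E \<Longrightarrow> lpa_class E a \<in> carrier L"
  by (auto simp: carrier_lpa)

lemma word_elt_reps: "set w \<subseteq> lpa_gens E \<Longrightarrow> w \<noteq> [] \<Longrightarrow> word_elt w \<in> lpa_reps E"
  by (simp add: word_elt_def lookup_single free_monoid_eq_0_iff)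

lemma cl_closed: "set w \<subseteq> lpa_gens E \<Longrightarrow> w \<noteq> [] \<Longrightarrow> cl w \<in> carrier L"
  unfolding cl_def by (intro class_closed word_elt_reps)

lemma cl_append:
  "set v \<subseteq> lpa_gens E \<Longrightarrow> set w \<subseteq> lpa_gens E \<Longrightarrow> cl (v @ w) = cl v \<otimes>\<^bsub>L\<^esub> cl w"
  unfolding cl_def by (simp only: word_elt_append mult_class word_elt_carrier)

lemma gens_iff [simp]:
  "Vertex v \<in> lpa_gens E \<longleftrightarrow> v \<in> verts E" "Edge e \<in> lpa_gens E \<longleftrightarrow> e \<in> arcs E"
  "Ghost e \<in> lpa_gens E \<longleftrightarrow> e \<in> arcs E"
  by (auto simp: lpa_gens_def)

lemma relation_class:
  assumes "a - b \<in> lpa_relations E" "a \<in> carrier F" "b \<in> carrier F"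
  shows "lpa_class E a = lpa_class E b"
proof -
  have "a - b \<in> lpa_ideal E"
    unfolding lpa_ideal_def
    by (rule subsetD[OF F.genideal_self[OF lpa_relations_carrier[OF wf_digraph_axioms]] assms(1)])
  with class_eq_iff[OF assms(2,3)] show ?thesis by (rule iffD2)
qed

lemma relation_cl:
  assumes "word_elt v - word_elt w \<in> (lpa_relations E :: (_ \<Rightarrow>\<^sub>0 'k) set)" "set v \<subseteq> lpa_gens E" "set w \<subseteq> lpa_gens E"
  shows "cl v = cl w"
  unfolding cl_def using assms by (intro relation_class word_elt_carrier)

lemma relation_cl_zero:
  assumes "word_elt v \<in> (lpa_relations E :: (_ \<Rightarrow>\<^sub>0 'k) set)" "set v \<subseteq> lpa_gens E"
  shows "cl v = \<zero>\<^bsub>L\<^esub>"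
  unfolding cl_def zero_class using assms by (intro relation_class word_elt_carrier) auto

lemma word_elt_pair: "word_elt [g, h] = letter g * letter h"
  by (simp add: letter_mult word_elt_def)

lemma cl_vertex_vertex:
  assumes "v \<in> verts E" "u \<in> verts E"
  shows "cl [Vertex v, Vertex u] = (if v = u then cl [Vertex v] else \<zero>\<^bsub>L\<^esub>)"
proof -
  have "word_elt [Vertex v, Vertex u] - (if v = u then word_elt [Vertex v] else 0 :: _ \<Rightarrow>\<^sub>0 'k)
      \<in> lpa_relations E"
    using assms unfolding lpa_relations_def word_elt_pair letter_eq_word_elt[symmetric] by blast
  then show ?thesis
    using assms by (cases "v = u") (simp_all add: relation_cl relation_cl_zero)
qed

lemma cl_ghost_edge:
  assumes "e \<in> arcs E" "f \<in> arcs E"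
  shows "cl [Ghost e, Edge f] = (if e = f then cl [Vertex (head E e)] else \<zero>\<^bsub>L\<^esub>)"
proof -
  have "word_elt [Ghost e, Edge f] - (if e = f then word_elt [Vertex (head E e)] else 0 :: _ \<Rightarrow>\<^sub>0 'k)
      \<in> lpa_relations E"
    using assms unfolding lpa_relations_def word_elt_pair letter_eq_word_elt[symmetric] by blast
  then show ?thesis
    using assms by (cases "e = f") (simp_all add: relation_cl relation_cl_zero)
qed

lemma cl_absorb:
  assumes "e \<in> arcs E"
  shows "cl [Vertex (tail E e), Edge e] = cl [Edge e]"
    and "cl [Edge e, Vertex (head E e)] = cl [Edge e]"
    and "cl [Vertex (head E e), Ghost e] = cl [Ghost e]"
    and "cl [Ghost e, Vertex (tail E e)] = cl [Ghost e]"
proof -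
  have "word_elt [Vertex (tail E e), Edge e] - word_elt [Edge e] \<in> (lpa_relations E :: (_ \<Rightarrow>\<^sub>0 'k) set)"
    "word_elt [Edge e, Vertex (head E e)] - word_elt [Edge e] \<in> (lpa_relations E :: (_ \<Rightarrow>\<^sub>0 'k) set)"
    "word_elt [Vertex (head E e), Ghost e] - word_elt [Ghost e] \<in> (lpa_relations E :: (_ \<Rightarrow>\<^sub>0 'k) set)"
    "word_elt [Ghost e, Vertex (tail E e)] - word_elt [Ghost e] \<in> (lpa_relations E :: (_ \<Rightarrow>\<^sub>0 'k) set)"
    using assms unfolding lpa_relations_def word_elt_pair letter_eq_word_elt[symmetric] by blast+
  from this[THEN relation_cl] assms show
    "cl [Vertex (tail E e), Edge e] = cl [Edge e]" "cl [Edge e, Vertex (head E e)] = cl [Edge e]"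
    "cl [Vertex (head E e), Ghost e] = cl [Ghost e]" "cl [Ghost e, Vertex (tail E e)] = cl [Ghost e]"
    by simp_all
qed

lemma cl_edge_ghost:
  assumes "out_arcs E (tail E e) = {e}" "e \<in> arcs E"
  shows "cl [Edge e, Ghost e] = cl [Vertex (tail E e)]"
proof -
  have "letter (Vertex (tail E e)) - (\<Sum>f\<in>out_arcs E (tail E e). letter (Edge f) * letter (Ghost f))
      \<in> (lpa_relations E :: (_ \<Rightarrow>\<^sub>0 'k) set)"
    unfolding lpa_relations_def using assms by (intro UnI2 CollectI exI[of _ "tail E e"]) auto
  then have "cl [Vertex (tail E e)] = cl [Edge e, Ghost e]"
    using assms by (intro relation_cl) (simp_all add: word_elt_pair letter_eq_word_elt[symmetric])
  then show ?thesis ..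
qed

text \<open>Rewriting of a factor inside a word; most computations below are chains of such
  replacements.\<close>

lemma cl_cong:
  assumes "cl v = cl w" "set v \<subseteq> lpa_gens E" "set w \<subseteq> lpa_gens E"
    "set x \<subseteq> lpa_gens E" "set y \<subseteq> lpa_gens E"
  shows "cl (x @ v @ y) = cl (x @ w @ y)"
  using assms by (simp add: cl_append)

lemma cl_zero_cong:
  assumes "cl v = \<zero>\<^bsub>L\<^esub>" "set v \<subseteq> lpa_gens E" "set x \<subseteq> lpa_gens E" "set y \<subseteq> lpa_gens E"
  shows "cl (x @ v @ y) = \<zero>\<^bsub>L\<^esub>"
proof -
  \<comment> \<open>The context may be empty, and then \<open>cl y\<close> is not in
    \<open>L\<close>; the products with zero are therefore computed on representatives in the free
    algebra.\<close>
  have "lpa_class E 0 \<otimes>\<^bsub>L\<^esub> cl y = lpa_class E 0"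
    using mult_class[OF _ word_elt_carrier[OF assms(4)], of 0] by (simp add: cl_def)
  moreover have "cl x \<otimes>\<^bsub>L\<^esub> lpa_class E 0 = lpa_class E 0"
    using mult_class[OF word_elt_carrier[OF assms(3)], of 0] by (simp add: cl_def)
  ultimately show ?thesis using assms by (simp add: cl_append zero_class)
qed

lemma cl_vertex_neq_zero: "v \<in> verts E \<Longrightarrow> cl [Vertex v] \<noteq> \<zero>\<^bsub>L\<^esub>"
  unfolding cl_def zero_class
  using vertex_notin_lpa_ideal[of v] by (subst class_eq_iff) (auto simp: letter_eq_word_elt word_elt_def)

text \<open>Inserting the source of \<open>e\<close> in front of \<open>e\<close> reduces this to
  the orthogonality of vertices.\<close>

lemma cl_vertex_edge:
  assumes "v \<in> verts E" "e \<in> arcs E"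
  shows "cl [Vertex v, Edge e] = (if v = tail E e then cl [Edge e] else \<zero>\<^bsub>L\<^esub>)"
proof -
  have "cl [Vertex v, Edge e] = cl [Vertex v, Vertex (tail E e), Edge e]"
    using cl_cong[OF cl_absorb(1)[OF assms(2)], of "[Vertex v]" "[]"] assms by simp
  also have "\<dots> = (if v = tail E e then cl [Edge e] else \<zero>\<^bsub>L\<^esub>)"
  proof (cases "v = tail E e")
    case True
    with assms show ?thesis
      using cl_cong[of "[Vertex v, Vertex (tail E e)]" "[Vertex v]" "[]" "[Edge e]"]
        cl_vertex_vertex[of v v] cl_absorb(1)[of e]
      by simp
  next
    case False
    with assms show ?thesis
      using cl_zero_cong[of "[Vertex v, Vertex (tail E e)]" "[]" "[Edge e]"] cl_vertex_vertex[of v "tail E e"]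
      by simp
  qed
  finally show ?thesis .
qed

text \<open>Inserting the range of \<open>e\<close> between the two edges reduces this to
  \<open>cl_vertex_edge\<close>.\<close>

lemma cl_edge_edge:
  assumes "e \<in> arcs E" "f \<in> arcs E" "head E e \<noteq> tail E f"
  shows "cl [Edge e, Edge f] = \<zero>\<^bsub>L\<^esub>"
  using cl_cong[OF cl_absorb(2)[OF assms(1)], of "[]" "[Edge f]"]
    cl_zero_cong[of "[Vertex (head E e), Edge f]" "[Edge e]" "[]"]
    cl_vertex_edge[of "head E e" f] assms
  by simp

lemma gens_image_iff [simp]:
  "Edge ` A \<subseteq> lpa_gens E \<longleftrightarrow> A \<subseteq> arcs E" "Ghost ` A \<subseteq> lpa_gens E \<longleftrightarrow> A \<subseteq> arcs E"
  by auto

text \<open>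
  A long initial segment of \<open>p\<close> absorbs all ghost edges of \<open>w\<close>, so that its product with \<open>w\<close> is
  zero or a real path, in accordance with the action of \<open>w\<close> on \<open>p\<close>.
\<close>

lemma cl_word_path:
  assumes p: "infinite_path E p" and w: "set w \<subseteq> lpa_gens E" "length w < n"
  shows "case word_act E w p of
      None \<Rightarrow> cl (w @ map Edge (map p [0..<n])) = \<zero>\<^bsub>L\<^esub>
    | Some q \<Rightarrow> \<exists>l. q = conc_path l (path_tail n p) \<and> set l \<subseteq> arcs E \<and> n \<le> length l + length w \<and>
        cl (w @ map Edge (map p [0..<n])) = cl (map Edge l)"
  using w
proof (induction w)
  case Nil
  have "set (map p [0..<n]) \<subseteq> arcs E" using p by (auto simp: infinite_path_def)
  then show ?case by (auto simp: conc_path_take intro!: exI[of _ "map p [0..<n]"])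
next
  case (Cons g w)
  let ?m = "map Edge (map p [0..<n])"
  have g: "g \<in> lpa_gens E" and w: "set w \<subseteq> lpa_gens E" using Cons.prems by auto
  have wm: "set (w @ ?m) \<subseteq> lpa_gens E" using w p by (auto simp: infinite_path_def)
  show ?case
  proof (cases "word_act E w p")
    case None
    then have "cl (w @ ?m) = \<zero>\<^bsub>L\<^esub>" using Cons by simp
    then have "cl ([g] @ (w @ ?m) @ []) = \<zero>\<^bsub>L\<^esub>" using g wm by (intro cl_zero_cong) auto
    with None show ?thesis by simp
  next
    case (Some q)
    then obtain l where l: "q = conc_path l (path_tail n p)" "set l \<subseteq> arcs E"
      "n \<le> length l + length w" "cl (w @ ?m) = cl (map Edge l)"
      using Cons by auto
    \<comment> \<open>The length bound leaves at least two edges in \<open>l\<close>. The second one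
      is needed to absorb the vertex that remains when a ghost edge cancels the first.\<close>
    from l(3) Cons.prems obtain f f' l' where l': "l = f # f' # l'"
      by (cases l; cases "tl l") auto
    have "set (map Edge l) \<subseteq> lpa_gens E" using l(2) by auto
    then have "cl ([g] @ (w @ ?m) @ []) = cl ([g] @ map Edge l @ [])"
      using l(4) g wm by (intro cl_cong) auto
    then have step: "cl ((g # w) @ ?m) = cl (g # Edge f # Edge f' # map Edge l')"
      by (simp add: l')
    have arcs: "f \<in> arcs E" "f' \<in> arcs E" "set l' \<subseteq> arcs E" using l(2) l' by auto
    have q: "q = case_nat f (case_nat f' (conc_path l' (path_tail n p)))"
      using l(1) l' by (simp add: conc_path_Cons)
    have "p \<in> tail_class E p" using p by (auto simp: tail_class_def intro: tail_equivalentI)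
    then have "q \<in> tail_class E p" by (rule word_act_tail_class[OF _ w Some])
    then have "head E (q 0) = tail E (q (Suc 0))" by (simp add: tail_class_def infinite_path_def)
    then have hd: "head E f = tail E f'" by (simp add: q)
    have ctx: "cl (v @ map Edge l') = cl (v' @ map Edge l')"
      if "cl v = cl v'" "set v \<subseteq> lpa_gens E" "set v' \<subseteq> lpa_gens E" for v v'
      using that arcs cl_cong[of v v' "[]" "map Edge l'"] by simp
    have ctx0: "cl (v @ Edge f' # map Edge l') = \<zero>\<^bsub>L\<^esub>"
      if "cl v = \<zero>\<^bsub>L\<^esub>" "set v \<subseteq> lpa_gens E" for v
      using that arcs cl_zero_cong[of v "[]" "Edge f' # map Edge l'"] by simp
    have q0: "q 0 = f" and q1: "path_tail 1 q = conc_path (f' # l') (path_tail n p)"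
      by (simp_all add: q conc_path_Cons path_tail_def)
    have succeeds: ?thesis if "gen_act E g q = Some (conc_path k (path_tail n p))" "set k \<subseteq> arcs E"
      "n \<le> Suc (length k + length w)" "cl (g # Edge f # Edge f' # map Edge l') = cl (map Edge k)" for k
      unfolding step word_act.simps Some bind.simps that(1) option.case using that(2-4) by auto
    have fails: ?thesis if "gen_act E g q = None"
      "cl (g # Edge f # Edge f' # map Edge l') = \<zero>\<^bsub>L\<^esub>"
      unfolding step word_act.simps Some bind.simps that(1) option.case by (rule that(2))
    show ?thesis
    proof (cases g)
      case (Vertex v)
      with g have v: "v \<in> verts E" by simp
      show ?thesis
      proof (cases "v = tail E f")
        case True
        then have "cl (g # Edge f # Edge f' # map Edge l') = cl (map Edge l)"
          using cl_cong[of "[Vertex v, Edge f]" "[Edge f]" "[]" "Edge f' # map Edge l'"]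
            cl_vertex_edge[of v f] Vertex v arcs l' by simp
        with True Vertex l(2,3) l(1)[symmetric] show ?thesis by (intro succeeds[of l]) (simp_all add: q0)
      next
        case False
        then have "cl (g # Edge f # Edge f' # map Edge l') = \<zero>\<^bsub>L\<^esub>"
          using ctx0[of "[Vertex v, Edge f]"] cl_vertex_edge[of v f] Vertex v arcs by simp
        with False Vertex show ?thesis by (intro fails) (simp_all add: q0)
      qed
    next
      case (Edge e)
      with g have e: "e \<in> arcs E" by simp
      show ?thesis
      proof (cases "head E e = tail E f")
        case True
        with e Edge l(2,3) l(1)[symmetric] l' arcs show ?thesis
          by (intro succeeds[of "e # l"]) (simp_all add: q0 conc_path_Cons)
      next
        case False
        then have "cl (g # Edge f # Edge f' # map Edge l') = \<zero>\<^bsub>L\<^esub>"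
          using ctx0[of "[Edge e, Edge f]"] cl_edge_edge[of e f] Edge e arcs by simp
        with False Edge show ?thesis by (intro fails) (simp_all add: q0)
      qed
    next
      case (Ghost e)
      with g have e: "e \<in> arcs E" by simp
      show ?thesis
      proof (cases "e = f")
        case True
        \<comment> \<open>The vertex produced by (CK1) is the source of \<open>f'\<close>, which
          absorbs it.\<close>
        have "cl ([Ghost f, Edge f] @ Edge f' # map Edge l') = cl ([Vertex (head E f)] @ Edge f' # map Edge l')"
          using cl_cong[of "[Ghost f, Edge f]" "[Vertex (head E f)]" "[]" "Edge f' # map Edge l'"]
            cl_ghost_edge[of f f] arcs by simp
        also have "\<dots> = cl ([Vertex (tail E f'), Edge f'] @ map Edge l')" by (simp add: hd)
        also have "\<dots> = cl ([Edge f'] @ map Edge l')"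
          using arcs by (intro ctx cl_absorb) simp_all
        finally have "cl (g # Edge f # Edge f' # map Edge l') = cl (map Edge (f' # l'))"
          using Ghost True by simp
        with True Ghost l(3) l' arcs q1 show ?thesis
          by (intro succeeds[of "f' # l'"]) (simp_all add: q0)
      next
        case False
        then have "cl (g # Edge f # Edge f' # map Edge l') = \<zero>\<^bsub>L\<^esub>"
          using ctx0[of "[Ghost e, Edge f]"] cl_ghost_edge[of e f] Ghost e arcs by simp
        with False Ghost show ?thesis by (intro fails) (simp_all add: q0)
      qed
    qed
  qed
qed

end

section \<open>The annihilator of an irrational path\<close>

text \<open>The linear map that sends a basis element \<open>q\<close> to the word
  \<open>\<gamma> q\<close>; it carries vectors of the Chen module to the free algebra.\<close>

definition extend_words ::
  "('a \<Rightarrow> 'g free_monoid) \<Rightarrow> ('a \<Rightarrow>\<^sub>0 'k) \<Rightarrow> ('g free_monoid \<Rightarrow>\<^sub>0 'k::field)" where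
  "extend_words \<gamma> x = (\<Sum>q\<in>Poly_Mapping.keys x. Poly_Mapping.single (\<gamma> q) (Poly_Mapping.lookup x q))"

lemma extend_words_superset:
  "finite A \<Longrightarrow> Poly_Mapping.keys x \<subseteq> A \<Longrightarrow>
    extend_words \<gamma> x = (\<Sum>q\<in>A. Poly_Mapping.single (\<gamma> q) (Poly_Mapping.lookup x q))"
  unfolding extend_words_def by (intro sum.mono_neutral_left) (auto simp: in_keys_iff)

lemma extend_words_0 [simp]: "extend_words \<gamma> 0 = 0"
  by (simp add: extend_words_def)

lemma extend_words_single: "extend_words \<gamma> (Poly_Mapping.single q c) = Poly_Mapping.single (\<gamma> q) c"
  by (simp add: extend_words_superset[of "{q}"])

lemma extend_words_add: "extend_words \<gamma> (x + y) = extend_words \<gamma> x + extend_words \<gamma> y"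
proof -
  let ?A = "Poly_Mapping.keys x \<union> Poly_Mapping.keys y"
  have "Poly_Mapping.keys (x + y) \<subseteq> ?A" by (rule keys_add)
  then show ?thesis
    by (simp add: extend_words_superset[of ?A] lookup_add single_add sum.distrib)
qed

context leavitt
begin

lemma class_mult_left_cong:
  assumes "a \<in> carrier F" "b \<in> carrier F" "c \<in> carrier F" "lpa_class E a = lpa_class E b"
  shows "lpa_class E (c * a) = lpa_class E (c * b)"
  using assms by (metis mult_class)

text \<open>If the initial segment is longer than every word of \<open>a\<close>, then by
  \<open>cl_word_path\<close> it turns each word into zero or a real path, and that path is
  determined by the image of \<open>p\<close> under the word. Hence the class of \<open>a\<close>
  times the segment is the image of the vector \<open>a p\<close> under a linear map, and vanishes
  with it.\<close>

lemma annihilator_kills_path: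
  assumes p: "irrational_path E p"
    and a: "a \<in> carrier F" "free_act E a (Poly_Mapping.single p 1) = 0"
  shows "\<exists>n. lpa_class E (a * word_elt (map Edge (map p [0..<Suc n]))) = \<zero>\<^bsub>L\<^esub>"
proof -
  have inf: "infinite_path E p" using p by (simp add: irrational_path_def)
  have "finite ((length \<circ> letters) ` Poly_Mapping.keys a)" by simp
  then obtain n where n: "length (letters w) < n" if "w \<in> Poly_Mapping.keys a" for w
    by (fastforce simp: finite_nat_set_iff_bounded)
  let ?\<tau> = "path_tail (Suc n) p"
  let ?m = "map Edge (map p [0..<Suc n])"
  \<comment> \<open>\<open>\<gamma>\<close> reads off the prefix in front of \<open>?\<tau>\<close>,
    which is unique by \<open>conc_path_inj\<close>; on paths not of this form its value is
    unspecified.\<close>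
  define \<gamma> where "\<gamma> q = Word (map Edge (THE l. q = conc_path l ?\<tau>) :: ('v, 'e) lpa_gen list)" for q
  have \<gamma>: "\<gamma> (conc_path l ?\<tau>) = Word (map Edge l)" for l
  proof -
    have "(THE k. conc_path l ?\<tau> = conc_path k ?\<tau>) = l"
      using conc_path_inj[OF wf_digraph_axioms p] by (intro the_equality) auto
    then show ?thesis by (simp add: \<gamma>_def)
  qed
  have m: "word_elt ?m \<in> carrier F"
    using inf by (intro word_elt_carrier) (auto simp: infinite_path_def)
  let ?G = "\<lambda>b. extend_words \<gamma> (free_act E b (Poly_Mapping.single p 1))"
  \<comment> \<open>The two memberships are carried through the induction because adding classes
    requires representatives in the free algebra.\<close>
  let ?Q = "\<lambda>b. b \<in> carrier F \<and> ?G b \<in> carrier F \<and> lpa_class E (b * word_elt ?m) = lpa_class E (?G b)"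
  have "?Q a"
  proof (induction a rule: poly_mapping_add_induct)
    case (single w c)
    then have w: "set (letters w) \<subseteq> lpa_gens E" using a(1) by auto
    have c: "Poly_Mapping.single 0 c \<in> carrier F" by (simp add: zero_free_monoid_def)
    have assoc: "Poly_Mapping.single w c * word_elt ?m = Poly_Mapping.single 0 c * word_elt (letters w @ ?m)"
      by (simp add: single_eq_scalar_mult_word_elt[of w] word_elt_append mult.assoc)
    have wm: "word_elt (letters w @ ?m) \<in> carrier F"
      using w inf by (intro word_elt_carrier) (auto simp: infinite_path_def)
    have w': "Poly_Mapping.single w c \<in> carrier F" using w by simp
    note red = cl_word_path[OF inf w less_SucI[OF n[OF single]]]
    show ?case
    proof (cases "word_act E (letters w) p")
      case None
      then have "?G (Poly_Mapping.single w c) = 0" by (simp add: free_act_single)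
      moreover have "lpa_class E (word_elt (letters w @ ?m) :: _ \<Rightarrow>\<^sub>0 'k) = lpa_class E 0"
        using red None by (simp add: cl_def zero_class)
      then have "lpa_class E (Poly_Mapping.single w c * word_elt ?m) = lpa_class E (Poly_Mapping.single 0 c * 0)"
        unfolding assoc by (intro class_mult_left_cong wm c) auto
      ultimately show ?thesis using w' by simp
    next
      case (Some q)
      with red obtain l where l: "q = conc_path l ?\<tau>" "set l \<subseteq> arcs E"
        "lpa_class E (word_elt (letters w @ ?m) :: _ \<Rightarrow>\<^sub>0 'k) = lpa_class E (word_elt (map Edge l))"
        unfolding cl_def by auto
      then have G: "?G (Poly_Mapping.single w c) = Poly_Mapping.single 0 c * word_elt (map Edge l)"
        using Some \<gamma>[of l] single_eq_scalar_mult_word_elt[of "Word (map Edge l)" c]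
        by (simp add: free_act_single extend_words_single)
      have e: "word_elt (map Edge l) \<in> carrier F" using l(2) by (intro word_elt_carrier) simp
      have "lpa_class E (Poly_Mapping.single w c * word_elt ?m) = lpa_class E (?G (Poly_Mapping.single w c))"
        unfolding assoc G using l(3) by (intro class_mult_left_cong wm c e)
      moreover have "?G (Poly_Mapping.single w c) \<in> carrier F"
        unfolding G using F.m_closed[OF c e] by simp
      ultimately show ?thesis using w' by blast
    qed
  next
    case (add x y)
    have G: "?G (x + y) = ?G x + ?G y" by (simp add: free_act_add_left extend_words_add)
    have cx: "x \<in> carrier F" "y \<in> carrier F" "?G x \<in> carrier F" "?G y \<in> carrier F"
      using add by blast+
    have xy: "x * word_elt ?m \<in> carrier F" "y * word_elt ?m \<in> carrier F"
      using F.m_closed[OF cx(1) m] F.m_closed[OF cx(2) m] by simp_all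
    have "lpa_class E ((x + y) * word_elt ?m) = lpa_class E (x * word_elt ?m) \<oplus>\<^bsub>L\<^esub> lpa_class E (y * word_elt ?m)"
      unfolding distrib_right using add_class[OF xy] ..
    also have "\<dots> = lpa_class E (?G x) \<oplus>\<^bsub>L\<^esub> lpa_class E (?G y)" using add by simp
    also have "\<dots> = lpa_class E (?G (x + y))" unfolding G by (rule add_class[OF cx(3,4)])
    finally have "lpa_class E ((x + y) * word_elt ?m) = lpa_class E (?G (x + y))" .
    moreover have "x + y \<in> carrier F" "?G x + ?G y \<in> carrier F"
      using F.a_closed[OF cx(1,2)] F.a_closed[OF cx(3,4)] by simp_all
    ultimately show ?case unfolding G by blast
  qed simp
  then have "lpa_class E (a * word_elt ?m) = \<zero>\<^bsub>L\<^esub>" using a(2) by (simp add: zero_class)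
  then show ?thesis ..
qed

text \<open>Each basis path is reached from \<open>p\<close> by removing an initial segment and
  prepending another, so \<open>p\<close> generates the module.\<close>

lemma ex_class_to:
  assumes p: "infinite_path E p" and x: "Poly_Mapping.keys x \<subseteq> tail_class E p"
  shows "\<exists>a\<in>lpa_reps E. free_act E a (Poly_Mapping.single p (1 :: 'k)) = x"
proof (induction x rule: poly_mapping_add_induct)
  case zero
  show ?case by (intro bexI[of _ 0]) auto
next
  case (single q c)
  with x have "q \<in> tail_class E p" by blast
  then obtain m n where q: "infinite_path E q" "path_tail m p = path_tail n q"
    by (auto simp: tail_class_def tail_equivalent_def)
  \<comment> \<open>The leading vertex fixes \<open>q\<close> and keeps the word nonempty when
    \<open>m\<close> and \<open>n\<close> are both zero.\<close>
  let ?w = "Vertex (tail E (q 0)) # map Edge (map q [0..<n]) @ map Ghost (rev (map p [0..<m]))"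
  have "path_tail 0 q = q" by (simp add: path_tail_def)
  then have "word_act E ?w p = Some q"
    using word_act_Edge[OF q(1), of 0 n] q(2) word_act_Ghost[of E p m]
    by (simp add: word_act_append)
  then have "free_act E (Poly_Mapping.single (Word ?w) c) (Poly_Mapping.single p 1) = Poly_Mapping.single q c"
    by (simp add: free_act_single)
  moreover have "Poly_Mapping.single (Word ?w) c \<in> lpa_reps E"
    using p q(1) by (auto simp: infinite_path_def lookup_single free_monoid_eq_0_iff)
  ultimately show ?case by blast
next
  case (add x y)
  then obtain a b where "a \<in> lpa_reps E" "free_act E a (Poly_Mapping.single p (1 :: 'k)) = x"
    "b \<in> lpa_reps E" "free_act E b (Poly_Mapping.single p (1 :: 'k)) = y" by blast
  then show ?case using lpa_reps_closed(2)[of a E b] by (intro bexI[of _ "a + b"]) (simp_all add: free_act_add_left)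
qed

end

section \<open>The idempotents of an infinite path\<close>

locale leavitt_path = leavitt +
  fixes p :: "nat \<Rightarrow> 'b"
  assumes path: "infinite_path E p"
begin

definition edges :: "nat \<Rightarrow> ('a, 'b) lpa_gen list" where
  "edges n = map Edge (map p [0..<Suc n])"

definition ghosts :: "nat \<Rightarrow> ('a, 'b) lpa_gen list" where
  "ghosts n = map Ghost (rev (map p [0..<Suc n]))"

lemma p_arcs: "p i \<in> arcs E" and p_head: "head E (p i) = tail E (p (Suc i))"
  using path by (simp_all add: infinite_path_def)

lemma gens: "set (edges n) \<subseteq> lpa_gens E" "set (ghosts n) \<subseteq> lpa_gens E"
  using p_arcs by (auto simp: edges_def ghosts_def)

lemma edges_Suc: "edges (Suc n) = edges n @ [Edge (p (Suc n))]"
  and ghosts_Suc: "ghosts (Suc n) = Ghost (p (Suc n)) # ghosts n"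
  and edges_snoc: "edges n = map Edge (map p [0..<n]) @ [Edge (p n)]"
  and ghosts_Cons: "ghosts n = Ghost (p n) # map Ghost (rev (map p [0..<n]))"
  by (simp_all add: edges_def ghosts_def)

lemma edges_Cons: "edges n = Edge (p 0) # map Edge (map p [Suc 0..<Suc n])"
  and ghosts_snoc: "ghosts n = map Ghost (rev (map p [Suc 0..<Suc n])) @ [Ghost (p 0)]"
  by (simp_all add: edges_def ghosts_def upt_conv_Cons del: upt_Suc)

lemma cl_vertex_edges:
  "set y \<subseteq> lpa_gens E \<Longrightarrow> cl (Vertex (tail E (p 0)) # edges n @ y) = cl (edges n @ y)"
  using cl_cong[OF cl_absorb(1)[of "p 0"], of "[]" "map Edge (map p [Suc 0..<Suc n]) @ y"]
    p_arcs tail_in_verts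
  by (simp add: edges_Cons image_subset_iff del: upt_Suc)

lemma cl_edges_vertex:
  "set y \<subseteq> lpa_gens E \<Longrightarrow> cl (edges n @ Vertex (head E (p n)) # y) = cl (edges n @ y)"
  using cl_cong[OF cl_absorb(2)[of "p n"], of "map Edge (map p [0..<n])" y] p_arcs head_in_verts
  by (simp add: edges_snoc image_subset_iff)

lemma cl_vertex_ghosts:
  "set x \<subseteq> lpa_gens E \<Longrightarrow> cl (x @ Vertex (head E (p n)) # ghosts n) = cl (x @ ghosts n)"
  using cl_cong[OF cl_absorb(3)[of "p n"], of x "map Ghost (rev (map p [0..<n]))"] p_arcs head_in_verts
  by (simp add: ghosts_Cons image_subset_iff)

lemma cl_ghosts_vertex:
  "set x \<subseteq> lpa_gens E \<Longrightarrow> cl (x @ ghosts n @ [Vertex (tail E (p 0))]) = cl (x @ ghosts n)"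
  using cl_cong[OF cl_absorb(4)[of "p 0"], of "x @ map Ghost (rev (map p [Suc 0..<Suc n]))" "[]"]
    p_arcs tail_in_verts
  by (simp add: ghosts_snoc image_subset_iff del: upt_Suc)

text \<open>The word contracts from the middle: the inner pair gives the range of
  \<open>p n\<close>, which is the source of the next edge, and (CK1) applies again.\<close>

lemma cl_ghosts_edges: "cl (ghosts n @ edges n) = cl [Vertex (head E (p n))]"
proof (induction n)
  case 0
  show ?case using cl_ghost_edge[of "p 0" "p 0"] p_arcs by (simp add: ghosts_def edges_def)
next
  case (Suc n)
  let ?e = "p (Suc n)"
  have "cl ([Ghost ?e] @ (ghosts n @ edges n) @ [Edge ?e])
      = cl ([Ghost ?e] @ [Vertex (head E (p n))] @ [Edge ?e])"
    using gens p_arcs head_in_verts by (intro cl_cong Suc) simp_all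
  also have "\<dots> = cl ([Ghost ?e] @ [Vertex (tail E ?e), Edge ?e] @ [])" by (simp add: p_head)
  also have "\<dots> = cl ([Ghost ?e] @ [Edge ?e] @ [])"
    using p_arcs tail_in_verts by (intro cl_cong cl_absorb) simp_all
  also have "\<dots> = cl [Vertex (head E ?e)]" using cl_ghost_edge[of ?e ?e] p_arcs by simp
  finally show ?case by (simp add: ghosts_Suc edges_Suc)
qed

lemma cl_ghosts_edges_cong:
  "set x \<subseteq> lpa_gens E \<Longrightarrow> set y \<subseteq> lpa_gens E \<Longrightarrow>
    cl (x @ ghosts n @ edges n @ y) = cl (x @ Vertex (head E (p n)) # y)"
  using cl_cong[OF cl_ghosts_edges, of n x y] gens p_arcs head_in_verts by simp

text \<open>\<open>path_proj n\<close> is \<open>p\<^bsub>n+1\<^esub> p\<^bsub>n+1\<^esub>\<^sup>*\<close>; the shift avoids the empty word, which is not in \<open>L\<close>.\<close>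

definition path_proj :: "nat \<Rightarrow> (('a, 'b) lpa_gen free_monoid \<Rightarrow>\<^sub>0 'c) set" where
  "path_proj n = cl (edges n @ ghosts n)"

lemma path_proj_closed: "path_proj n \<in> carrier L"
  unfolding path_proj_def using gens by (intro cl_closed) (simp_all add: edges_def)

lemma path_proj_idem: "path_proj n \<otimes>\<^bsub>L\<^esub> path_proj n = path_proj n"
  unfolding path_proj_def using gens cl_ghosts_edges_cong[of "edges n" "ghosts n" n] cl_edges_vertex[of "ghosts n" n]
  by (simp flip: cl_append)

text \<open>One factor splits as \<open>edges n @ ?y\<close> or \<open>?x @ ghosts n\<close>; in the
  product \<open>ghosts n @ edges n\<close> contracts to a vertex, which the neighbouring letters
  absorb.\<close>

lemma path_proj_Suc: "path_proj n \<otimes>\<^bsub>L\<^esub> path_proj (Suc n) = path_proj (Suc n)" "path_proj (Suc n) \<otimes>\<^bsub>L\<^esub> path_proj n = path_proj (Suc n)"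
proof -
  let ?e = "p (Suc n)"
  let ?y = "Edge ?e # ghosts (Suc n)" and ?x = "edges (Suc n) @ [Ghost ?e]"
  have xy: "set ?x \<subseteq> lpa_gens E" "set ?y \<subseteq> lpa_gens E" using gens p_arcs by simp_all
  show "path_proj n \<otimes>\<^bsub>L\<^esub> path_proj (Suc n) = path_proj (Suc n)"
    using cl_ghosts_edges_cong[OF gens(1) xy(2), of n n] cl_edges_vertex[OF xy(2), of n] gens p_arcs
    by (simp add: path_proj_def edges_Suc flip: cl_append)
  show "path_proj (Suc n) \<otimes>\<^bsub>L\<^esub> path_proj n = path_proj (Suc n)"
    using cl_ghosts_edges_cong[OF xy(1) gens(2), of n n] cl_vertex_ghosts[OF xy(1), of n] gens p_arcs
    by (simp add: path_proj_def ghosts_Suc flip: cl_append)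
qed

lemma path_proj_mult:
  assumes "m \<le> n"
  shows "path_proj m \<otimes>\<^bsub>L\<^esub> path_proj n = path_proj n" "path_proj n \<otimes>\<^bsub>L\<^esub> path_proj m = path_proj n"
proof -
  show "path_proj m \<otimes>\<^bsub>L\<^esub> path_proj n = path_proj n" using assms
  proof (induction n rule: dec_induct)
    case (step n)
    then show ?case by (metis L.m_assoc path_proj_Suc(1) path_proj_closed)
  qed (rule path_proj_idem)
  show "path_proj n \<otimes>\<^bsub>L\<^esub> path_proj m = path_proj n" using assms
  proof (induction n rule: dec_induct)
    case (step n)
    then show ?case by (metis L.m_assoc path_proj_Suc(2) path_proj_closed)
  qed (rule path_proj_idem)
qed

lemma path_proj_vertex:
  "cl [Vertex (tail E (p 0))] \<otimes>\<^bsub>L\<^esub> path_proj n = path_proj n" "path_proj n \<otimes>\<^bsub>L\<^esub> cl [Vertex (tail E (p 0))] = path_proj n"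
  using cl_vertex_edges[OF gens(2), of n n] cl_ghosts_vertex[OF gens(1), of n n] gens p_arcs tail_in_verts
  by (simp_all add: path_proj_def flip: cl_append)

text \<open>Without exits, (CK2) at the source of the edge has a single summand, so the edge and its
  ghost cancel to a vertex. An exit \<open>f\<close> separates the two projections: after
  multiplication by suitable words on both sides one becomes the nonzero vertex
  \<open>head E f\<close>, the other zero.\<close>

lemma path_proj_Suc_eq_iff: "path_proj (Suc n) = path_proj n \<longleftrightarrow> path_exits E p (Suc n) = {}"
proof
  let ?e = "p (Suc n)"
  assume "path_exits E p (Suc n) = {}"
  then have "out_arcs E (tail E ?e) = {?e}" using p_arcs by (auto simp: path_exits_def)
  then have "cl (edges n @ [Edge ?e, Ghost ?e] @ ghosts n) = cl (edges n @ [Vertex (tail E ?e)] @ ghosts n)"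
    using gens p_arcs tail_in_verts by (intro cl_cong cl_edge_ghost) simp_all
  then show "path_proj (Suc n) = path_proj n"
    using cl_edges_vertex[OF gens(2), of n n] by (simp add: path_proj_def edges_Suc ghosts_Suc p_head)
next
  let ?e = "p (Suc n)"
  assume eq: "path_proj (Suc n) = path_proj n"
  show "path_exits E p (Suc n) = {}"
  proof (rule ccontr)
    assume "path_exits E p (Suc n) \<noteq> {}"
    then obtain f where f: "f \<in> arcs E" "tail E f = tail E ?e" "f \<noteq> ?e"
      by (auto simp: path_exits_def)
    \<comment> \<open>These words strip the common initial segment from both sides and then test
      against \<open>f\<close>.\<close>
    let ?x = "Ghost f # ghosts n" and ?y = "edges n @ [Edge f]"
    have gens_f: "Ghost f \<in> lpa_gens E" "Edge f \<in> lpa_gens E" "Vertex (tail E f) \<in> lpa_gens E"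
      "Edge ?e \<in> lpa_gens E" "Ghost ?e \<in> lpa_gens E"
      using f(1) p_arcs tail_in_verts by simp_all
    have hd: "head E (p n) = tail E f" using f(2) p_head by simp
    have "cl (?x @ (edges n @ ghosts n) @ ?y) = cl ([Ghost f] @ ghosts n @ edges n @ ghosts n @ edges n @ [Edge f])"
      by simp
    also have "\<dots> = cl ((Ghost f # Vertex (tail E f) # []) @ ghosts n @ edges n @ [Edge f])"
      using gens gens_f by (subst cl_ghosts_edges_cong) (simp_all add: hd)
    also have "\<dots> = cl ([Ghost f] @ [Vertex (tail E f), Vertex (tail E f)] @ [Edge f])"
      using gens gens_f by (subst cl_ghosts_edges_cong) (simp_all add: hd)
    also have "\<dots> = cl ([Ghost f] @ [Vertex (tail E f)] @ [Edge f])"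
      using f(1) cl_vertex_vertex[of "tail E f" "tail E f"] by (intro cl_cong) simp_all
    also have "\<dots> = cl ([Ghost f] @ [Vertex (tail E f), Edge f] @ [])" by simp
    also have "\<dots> = cl ([Ghost f] @ [Edge f] @ [])"
      using f(1) by (intro cl_cong cl_absorb) simp_all
    also have "\<dots> = cl [Vertex (head E f)]" using cl_ghost_edge[of f f] f(1) by simp
    finally have 1: "cl (?x @ (edges n @ ghosts n) @ ?y) = cl [Vertex (head E f)]" .
    \<comment> \<open>What follows the product of the ghost edge of \<open>f\<close> with
      \<open>?e\<close>; that product is zero by (CK1), as \<open>f\<close> differs from
      \<open>?e\<close>.\<close>
    let ?z = "Ghost ?e # ghosts n @ edges n @ [Edge f]"
    have z: "set ?z \<subseteq> lpa_gens E" using gens gens_f by simp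
    have "cl (?x @ (edges (Suc n) @ ghosts (Suc n)) @ ?y) = cl ([Ghost f] @ ghosts n @ edges n @ Edge ?e # ?z)"
      by (simp add: edges_Suc ghosts_Suc)
    also have "\<dots> = cl ([Ghost f] @ [Vertex (tail E ?e), Edge ?e] @ ?z)"
      using gens gens_f z by (subst cl_ghosts_edges_cong) (simp_all add: p_head)
    also have "\<dots> = cl ([Ghost f] @ [Edge ?e] @ ?z)"
      using z gens_f p_arcs by (intro cl_cong cl_absorb) simp_all
    also have "\<dots> = cl ([] @ [Ghost f, Edge ?e] @ ?z)" by simp
    also have "\<dots> = \<zero>\<^bsub>L\<^esub>"
      using z gens_f f cl_ghost_edge[of f ?e] p_arcs by (intro cl_zero_cong) simp_all
    also have "cl (?x @ (edges (Suc n) @ ghosts (Suc n)) @ ?y) = cl (?x @ (edges n @ ghosts n) @ ?y)"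
      using eq gens gens_f unfolding path_proj_def by (intro cl_cong) simp_all
    finally have "cl [Vertex (head E f)] = \<zero>\<^bsub>L\<^esub>" using 1 by simp
    then show False using cl_vertex_neq_zero[of "head E f"] f(1) by simp
  qed
qed

lemma path_proj_eventually_constant_iff:
  "(\<exists>N. \<forall>n\<ge>N. path_proj n = path_proj N) \<longleftrightarrow> finite {i. path_exits E p i \<noteq> {}}"
proof
  assume "\<exists>N. \<forall>n\<ge>N. path_proj n = path_proj N"
  then obtain N where N: "\<And>n. n \<ge> N \<Longrightarrow> path_proj n = path_proj N" by blast
  have "i \<le> N" if "path_exits E p i \<noteq> {}" for i
  proof (rule ccontr)
    assume "\<not> i \<le> N"
    \<comment> \<open>Only positive indices are governed by \<open>path_proj_Suc_eq_iff\<close>; the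
      index 0 is never beyond \<open>N\<close>.\<close>
    then obtain n where "i = Suc n" "n \<ge> N" by (cases i) auto
    with that N[of n] N[of "Suc n"] path_proj_Suc_eq_iff[of n] show False by simp
  qed
  then show "finite {i. path_exits E p i \<noteq> {}}" unfolding finite_nat_set_iff_bounded_le by blast
next
  assume "finite {i. path_exits E p i \<noteq> {}}"
  then obtain N where N: "\<And>i. path_exits E p i \<noteq> {} \<Longrightarrow> i < N"
    unfolding finite_nat_set_iff_bounded by blast
  have "path_proj n = path_proj N" if "n \<ge> N" for n
    using that
  proof (induction n rule: dec_induct)
    case (step n)
    have "path_exits E p (Suc n) = {}" using N[of "Suc n"] step by linarith
    with step show ?case using path_proj_Suc_eq_iff[of n] by simp
  qed simp
  then show "\<exists>N. \<forall>n\<ge>N. path_proj n = path_proj N" by blast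
qed

end

section \<open>Finite presentation of the Chen module\<close>

text \<open>The criterion is applied to the generator \<open>p\<close>, the idempotent at its
  source, and the projections \<open>path_proj n\<close>, which all fix \<open>p\<close>.\<close>

lemma (in leavitt) finitely_presented_chen_module_iff:
  assumes p: "irrational_path E p"
  shows "finitely_presented L (chen_module K E p) \<longleftrightarrow> finite {i. path_exits E p i \<noteq> {}}"
proof -
  interpret leavitt_path E K p
    using p by unfold_locales (simp add: irrational_path_def)
  let ?V = "chen_module K E p" and ?x = "Poly_Mapping.single p (1 :: 'k)"
    and ?v = "cl [Vertex (tail E (p 0))]"
  interpret V: unital_left_module L ?V
    by (rule unital_left_module_chen_module) (rule wf_digraph_axioms)
  have x: "?x \<in> carrier ?V" using path by (auto simp: tail_class_def intro: tail_equivalentI)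
  have smult: "lpa_class E a \<odot>\<^bsub>?V\<^esub> ?x = free_act E a ?x" if "a \<in> carrier F" for a
    by (rule chen_smult[OF wf_digraph_axioms that x])
  have smult_cl: "cl w \<odot>\<^bsub>?V\<^esub> ?x = word_vec E (Word w) p 1" if "set w \<subseteq> lpa_gens E" for w
    unfolding cl_def using that by (subst smult) (simp_all add: word_elt_def free_act_single split: option.split)
  have "finitely_presented L ?V \<longleftrightarrow> (\<exists>N. \<forall>n\<ge>N. path_proj n = path_proj N)"
  proof (rule V.finitely_presented_iff_eventually_constant)
    have v: "tail E (p 0) \<in> verts E" using p_arcs by simp
    then show "?v \<in> carrier L" by (intro cl_closed) simp_all
    show "?v \<otimes>\<^bsub>L\<^esub> ?v = ?v"
      using v cl_vertex_vertex[OF v v] cl_append[of "[Vertex (tail E (p 0))]" "[Vertex (tail E (p 0))]"]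
      by simp
    show "?v \<odot>\<^bsub>?V\<^esub> ?x = ?x" using v by (simp add: smult_cl)
    fix n
    show "path_proj n \<odot>\<^bsub>?V\<^esub> ?x = ?x"
    proof -
      have "path_tail 0 p = p" by (simp add: path_tail_def)
      then have "word_act E (edges n @ ghosts n) p = Some p"
        using word_act_Edge[OF path, of 0 "Suc n"] word_act_Ghost[of E p "Suc n"]
        by (simp add: word_act_append edges_def ghosts_def)
      then show ?thesis unfolding path_proj_def using gens by (subst smult_cl) simp_all
    qed
  next
    fix y assume "y \<in> carrier ?V"
    then obtain a where "a \<in> lpa_reps E" "free_act E a ?x = y"
      using ex_class_to[OF path, of y] by auto
    then show "\<exists>A\<in>carrier L. A \<odot>\<^bsub>?V\<^esub> ?x = y"
      using smult[of a] by (intro bexI[of _ "lpa_class E a"] class_closed) simp_all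
  next
    fix A assume A: "A \<in> carrier L" "A \<odot>\<^bsub>?V\<^esub> ?x = \<zero>\<^bsub>?V\<^esub>"
    then obtain a where a: "A = lpa_class E a" "a \<in> carrier F" by (auto simp: carrier_lpa)
    with A(2) smult have "free_act E a ?x = 0" by simp
    then obtain n where "lpa_class E (a * word_elt (edges n)) = \<zero>\<^bsub>L\<^esub>"
      using annihilator_kills_path[OF p a(2)] unfolding edges_def by blast
    then have n: "A \<otimes>\<^bsub>L\<^esub> cl (edges n) = \<zero>\<^bsub>L\<^esub>"
      unfolding cl_def a(1) using a(2) gens by (subst mult_class) (simp_all add: word_elt_def)
    \<comment> \<open>An initial segment killed by \<open>A\<close> from the left gives a projection
      killed by \<open>A\<close>, as the projection starts with that segment.\<close>
    have "A \<otimes>\<^bsub>L\<^esub> path_proj n = (A \<otimes>\<^bsub>L\<^esub> cl (edges n)) \<otimes>\<^bsub>L\<^esub> cl (ghosts n)"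
      unfolding path_proj_def cl_append[OF gens] using A(1) gens
      by (intro L.m_assoc[symmetric] cl_closed) (simp_all add: edges_def ghosts_def)
    also have "\<dots> = \<zero>\<^bsub>L\<^esub>"
      unfolding n using gens by (intro L.l_null cl_closed) (simp_all add: ghosts_def)
    finally show "\<exists>n. A \<otimes>\<^bsub>L\<^esub> path_proj n = \<zero>\<^bsub>L\<^esub>" ..
  qed (use x path_proj_closed path_proj_vertex path_proj_mult in blast)+
  then show ?thesis using path_proj_eventually_constant_iff by blast
qed

theorem theorem2p20:
  fixes K :: "'k::field itself"
    and E :: "('v, 'e) pre_digraph"
    and p :: "nat \<Rightarrow> 'e"
  assumes "wf_digraph E"
    and "irrational_path E p"
    and "\<forall>i. finite (out_arcs E (tail E (p i)))"
  shows "(finitely_presented (leavitt_path_algebra K E) (chen_module K E p) \<longleftrightarrow>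
            finite {i. path_exits E p i \<noteq> {}}) \<and>
         (fin_digraph E \<longrightarrow>
            \<not> finitely_presented (leavitt_path_algebra K E) (chen_module K E p))"
proof -
  interpret leavitt E K using assms(1) by (rule leavitt.intro)
  \<comment> \<open>In a finite graph, exits that stop at some index would make \<open>p\<close>
    rational.\<close>
  have "infinite {i. path_exits E p i \<noteq> {}}" if "fin_digraph E"
  proof
    interpret fin_digraph E by fact
    assume "finite {i. path_exits E p i \<noteq> {}}"
    then obtain N where "\<And>i. path_exits E p i \<noteq> {} \<Longrightarrow> i < N"
      unfolding finite_nat_set_iff_bounded by blast
    then have "\<And>i. i \<ge> N \<Longrightarrow> path_exits E p i = {}" by (meson not_le)
    then have "rational_path E p"
      using assms(2) by (intro rational_path_if_eventually_no_exits[of p N]) (auto simp: irrational_path_def)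
    with assms(2) show False by (simp add: irrational_path_def)
  qed
  then show ?thesis using finitely_presented_chen_module_iff[OF assms(2)] by blast
qed

end
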